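(* There is a family of unsatisfiable CNF formulas $\{F_n\}_{n=0}^\infty$, with $F_n$ having $\exp(\Theta(n\log n))$ many variables, such that $\mathrm{VSpace}_{\mathrm{PC}}(F_n\vdash)=O(n)$ and $\mathrm{VSpace}_{\mathrm{MC}}(F_n\vdash)=\Omega(n^2)$.
   Context: CNF formulas are encoded as polynomials over a field $\mathbb F$: a clause $\bigvee_{x\in P}x\vee\bigvee_{y\in N}\bar y$ becomes $\prod_{x\in P}(1-x)\prod_{y\in N}y$; Boolean axioms $x_i^2-x_i$ are available. Polynomial Calculus (PC) uses linear combination ($\alpha p+\beta q$, $\alpha,\beta\in\mathbb F$) and multiplication $p\mapsto x_ip$ of any polynomial by a variable; Monomial Calculus (MC) is the same but multiplication is only allowed when $p$ is a monomial or the product of a monomial and an axiom. A configurational refutation is a sequence of sets of polynomials $C_0=\emptyset,\dots,C_t=\{1\}$, each obtained from the previous by adding an axiom, erasing a polynomial, or adding a polynomial inferred by a rule of the system. Its variable space is the maximum number of distinct variables in one configuration; $\mathrm{VSpace}_{\mathcal C}(F\vdash)$ is the minimum variable space of a refutation of (the encoding of) $F$ in system $\mathcal C$. *)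

theory Defs
  imports "HOL-Library.Poly_Mapping" "HOL-Library.Landau_Symbols"
begin

section \<open>CNF formulas\<close>

text \<open>The pair \<open>(P, N)\<close> is the clause with positive literals \<open>P\<close> and negated variables \<open>N\<close>.\<close>

type_synonym clause = "nat set \<times> nat set"
type_synonym cnf = "clause set"

definition is_cnf :: "cnf \<Rightarrow> bool" where
  "is_cnf F \<longleftrightarrow> finite F \<and> (\<forall>(P, N)\<in>F. finite P \<and> finite N)"

definition cnf_vars :: "cnf \<Rightarrow> nat set" where
  "cnf_vars F = (\<Union>(P, N)\<in>F. P \<union> N)"

definition satisfies :: "(nat \<Rightarrow> bool) \<Rightarrow> cnf \<Rightarrow> bool" where
  "satisfies \<tau> F \<longleftrightarrow> (\<forall>(P, N)\<in>F. (\<exists>x\<in>P. \<tau> x) \<or> (\<exists>y\<in>N. \<not> \<tau> y))"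

definition unsatisfiable :: "cnf \<Rightarrow> bool" where
  "unsatisfiable F \<longleftrightarrow> (\<nexists>\<tau>. satisfies \<tau> F)"


section \<open>Polynomials and the encoding of CNF formulas\<close>

text \<open>
  Power products are finitely supported exponent functions \<open>nat \<Rightarrow>\<^sub>0 nat\<close>; the ring structure
  on \<open>'a mpoly\<close> is the convolution product of \<^theory>\<open>HOL-Library.Poly_Mapping\<close>.
\<close>

type_synonym 'a mpoly = "(nat \<Rightarrow>\<^sub>0 nat) \<Rightarrow>\<^sub>0 'a"

definition Const :: "'a::field \<Rightarrow> 'a mpoly" where
  "Const c = Poly_Mapping.single 0 c"

definition monomial :: "(nat \<Rightarrow>\<^sub>0 nat) \<Rightarrow> 'a::field mpoly" where
  "monomial m = Poly_Mapping.single m 1"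

definition Var :: "nat \<Rightarrow> 'a::field mpoly" where
  "Var x = monomial (Poly_Mapping.single x 1)"

definition poly_vars :: "'a::field mpoly \<Rightarrow> nat set" where
  "poly_vars p = (\<Union>m\<in>Poly_Mapping.keys p. Poly_Mapping.keys m)"

fun clause_poly :: "clause \<Rightarrow> 'a::field mpoly" where
  "clause_poly (P, N) = (\<Prod>x\<in>P. 1 - Var x) * (\<Prod>y\<in>N. Var y)"

definition axioms_of :: "cnf \<Rightarrow> 'a::field mpoly set" where
  "axioms_of F = clause_poly ` F \<union> (\<lambda>x. Var x ^ 2 - Var x) ` cnf_vars F"


section \<open>Polynomial Calculus and Monomial Calculus\<close>

text \<open>
  Monomials have coefficient 1; allowing scalar multiples in the MC multiplication rule would not
  change the variable space, since linear combinations can rescale a polynomial.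
\<close>

datatype proof_system = PC | MC

fun multiplicable :: "proof_system \<Rightarrow> cnf \<Rightarrow> 'a::field mpoly \<Rightarrow> bool" where
  "multiplicable PC F p \<longleftrightarrow> True"
| "multiplicable MC F p \<longleftrightarrow>
     (\<exists>m. p = monomial m) \<or> (\<exists>m. \<exists>a\<in>axioms_of F. p = monomial m * a)"

inductive infers :: "proof_system \<Rightarrow> cnf \<Rightarrow> 'a::field mpoly set \<Rightarrow> 'a mpoly \<Rightarrow> bool"
  for S F C where
  lin_comb: "p \<in> C \<Longrightarrow> q \<in> C \<Longrightarrow> infers S F C (Const \<alpha> * p + Const \<beta> * q)"
| multiply: "p \<in> C \<Longrightarrow> multiplicable S F p \<Longrightarrow> x \<in> cnf_vars F \<Longrightarrow> infers S F C (Var x * p)"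

inductive step :: "proof_system \<Rightarrow> cnf \<Rightarrow> 'a::field mpoly set \<Rightarrow> 'a mpoly set \<Rightarrow> bool"
  for S F C where
  download: "a \<in> axioms_of F \<Longrightarrow> step S F C (insert a C)"
| erase: "p \<in> C \<Longrightarrow> step S F C (C - {p})"
| infer: "infers S F C p \<Longrightarrow> step S F C (insert p C)"

definition refutation :: "proof_system \<Rightarrow> cnf \<Rightarrow> 'a::field mpoly set list \<Rightarrow> bool" where
  "refutation S F Cs \<longleftrightarrow>
     Cs \<noteq> [] \<and> hd Cs = {} \<and> last Cs = {1} \<and>
     (\<forall>i. Suc i < length Cs \<longrightarrow> step S F (Cs ! i) (Cs ! Suc i))"

definition variable_space :: "'a::field mpoly set list \<Rightarrow> nat" where
  "variable_space Cs = Max ((\<lambda>C. card (\<Union>p\<in>C. poly_vars p)) ` set Cs)"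

text \<open>
  The dummy argument \<open>TYPE('a)\<close> selects the coefficient field. The least element exists
  whenever \<open>F\<close> is an unsatisfiable CNF formula, see \<open>refutation_exists\<close> below.
\<close>

definition VSpace :: "proof_system \<Rightarrow> 'a::field itself \<Rightarrow> cnf \<Rightarrow> nat" where
  "VSpace S K F =
     (LEAST s. \<exists>Cs :: 'a mpoly set list. refutation S F Cs \<and> variable_space Cs = s)"


section \<open>Every unsatisfiable CNF formula has a refutation\<close>

inductive derivable :: "proof_system \<Rightarrow> cnf \<Rightarrow> 'a::field mpoly \<Rightarrow> bool" for S F where
  ax: "a \<in> axioms_of F \<Longrightarrow> derivable S F a"
| lin: "derivable S F p \<Longrightarrow> derivable S F q \<Longrightarrow> derivable S F (Const \<alpha> * p + Const \<beta> * q)"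
| mul: "derivable S F p \<Longrightarrow> multiplicable S F p \<Longrightarrow> x \<in> cnf_vars F \<Longrightarrow> derivable S F (Var x * p)"

lemma derivable_reach:
  assumes "derivable S F p" "finite C"
  shows "\<exists>D. (step S F)\<^sup>*\<^sup>* C D \<and> finite D \<and> C \<subseteq> D \<and> p \<in> D"
  using assms
proof (induction arbitrary: C)
  case (ax a)
  then show ?case
    by (intro exI[of _ "insert a C"]) (auto intro: step.download)
next
  case (lin p q \<alpha> \<beta>)
  obtain D where D: "(step S F)\<^sup>*\<^sup>* C D" "finite D" "C \<subseteq> D" "p \<in> D"
    using lin.IH(1) lin.prems by blast
  obtain E where E: "(step S F)\<^sup>*\<^sup>* D E" "finite E" "D \<subseteq> E" "q \<in> E"
    using lin.IH(2) D(2) by blast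
  have "step S F E (insert (Const \<alpha> * p + Const \<beta> * q) E)"
    using D E by (intro step.infer infers.lin_comb) auto
  then have "(step S F)\<^sup>*\<^sup>* C (insert (Const \<alpha> * p + Const \<beta> * q) E)"
    using D(1) E(1) by (meson rtranclp.rtrancl_into_rtrancl rtranclp_trans)
  then show ?case
    using D E by (intro exI[of _ "insert (Const \<alpha> * p + Const \<beta> * q) E"]) auto
next
  case (mul p x)
  obtain D where D: "(step S F)\<^sup>*\<^sup>* C D" "finite D" "C \<subseteq> D" "p \<in> D"
    using mul.IH mul.prems by blast
  have "step S F D (insert (Var x * p) D)"
    using D mul by (intro step.infer infers.multiply) auto
  then have "(step S F)\<^sup>*\<^sup>* C (insert (Var x * p) D)"
    using D(1) by (meson rtranclp.rtrancl_into_rtrancl)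
  then show ?case
    using D by (intro exI[of _ "insert (Var x * p) D"]) auto
qed

lemma reach_erase:
  assumes "finite E" "E \<inter> D = {}"
  shows "(step S F)\<^sup>*\<^sup>* (D \<union> E) D"
  using assms
proof (induction E rule: finite_induct)
  case (insert p E)
  have "step S F (D \<union> insert p E) (D \<union> insert p E - {p})"
    by (intro step.erase) auto
  moreover have "D \<union> insert p E - {p} = D \<union> E"
    using insert by auto
  ultimately show ?case
    using insert by (auto intro: converse_rtranclp_into_rtranclp)
qed auto

lemma reach_list:
  assumes "(step S F)\<^sup>*\<^sup>* C D"
  shows "\<exists>Cs. Cs \<noteq> [] \<and> hd Cs = C \<and> last Cs = D \<and>
           (\<forall>i. Suc i < length Cs \<longrightarrow> step S F (Cs ! i) (Cs ! Suc i))"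
  using assms
proof (induction rule: converse_rtranclp_induct)
  case base
  then show ?case by (intro exI[of _ "[D]"]) auto
next
  case (step B C)
  then obtain Cs where Cs: "Cs \<noteq> []" "hd Cs = C" "last Cs = D"
      "\<forall>i. Suc i < length Cs \<longrightarrow> step S F (Cs ! i) (Cs ! Suc i)"
    by blast
  have "step S F ((B # Cs) ! i) ((B # Cs) ! Suc i)" if "Suc i < length (B # Cs)" for i
    using that step.hyps(1) Cs by (cases i) (auto simp: hd_conv_nth)
  then show ?case
    using Cs by (intro exI[of _ "B # Cs"]) auto
qed

lemma Const_0 [simp]: "Const 0 = 0"
  and Const_1 [simp]: "Const 1 = 1"
  by (simp_all add: Const_def)

lemma Const_uminus: "Const (- c) = - Const c"
  by (simp add: Const_def single_uminus)

lemma derivable_diff: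
  assumes "derivable S F p" "derivable S F q"
  shows "derivable S F (p - q)"
  using derivable.lin[OF assms, of 1 "- 1"] by (simp add: Const_uminus)

lemma derivable_add:
  assumes "derivable S F p" "derivable S F q"
  shows "derivable S F (p + q)"
  using derivable.lin[OF assms, of 1 1] by simp

lemma derivable_sum:
  assumes "finite A" "A \<noteq> {}" "\<And>x. x \<in> A \<Longrightarrow> derivable S F (f x)"
  shows "derivable S F (sum f A)"
  using assms by (induction rule: finite_ne_induct) (auto intro: derivable_add)

lemma Var_prod_list_eq: "\<exists>m. prod_list (map Var xs) = (monomial m :: 'a::field mpoly)"
proof (induction xs)
  case Nil
  show ?case by (intro exI[of _ 0]) (simp add: monomial_def)
next
  case (Cons x xs)
  then obtain m where "prod_list (map Var xs) = (monomial m :: 'a mpoly)" by blast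
  then have "prod_list (map Var (x # xs)) = (Var x * monomial m :: 'a mpoly)" by simp
  also have "\<dots> = monomial (Poly_Mapping.single x 1 + m)"
    by (simp add: Var_def monomial_def mult_single)
  finally show ?case by blast
qed

lemma derivable_axiom_mult:
  assumes "a \<in> axioms_of F" "set xs \<subseteq> cnf_vars F"
  shows "derivable S F (prod_list (map Var xs) * a)"
  using assms(2)
proof (induction xs)
  case Nil
  then show ?case using assms(1) by (auto intro: derivable.ax)
next
  case (Cons x xs)
  have "multiplicable S F (prod_list (map Var xs) * a)"
    using Var_prod_list_eq[of xs] assms(1) by (cases S) fastforce+
  then have "derivable S F (Var x * (prod_list (map Var xs) * a))"
    using Cons by (intro derivable.mul) auto
  then show ?case by (simp add: mult.assoc)
qed

lemma derivable_cube:
  assumes a: "a \<in> axioms_of F" and "finite B" "finite D" "B \<subseteq> cnf_vars F" "D \<subseteq> cnf_vars F"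
    and "set xs \<subseteq> cnf_vars F"
  shows "derivable S F (prod_list (map Var xs) * ((\<Prod>x\<in>B. Var x) * (\<Prod>y\<in>D. 1 - Var y) * a))"
  using assms(3-)
proof (induction D arbitrary: xs rule: finite_induct)
  case empty
  from \<open>finite B\<close> empty(1,3) show ?case
  proof (induction B arbitrary: xs rule: finite_induct)
    case empty
    then show ?case using derivable_axiom_mult[OF a, of xs S] by simp
  next
    case (insert b B)
    then have "derivable S F (prod_list (map Var (b # xs)) * ((\<Prod>x\<in>B. Var x) * (\<Prod>y\<in>{}. 1 - Var y) * a))"
      by (intro insert.IH) auto
    then show ?case using insert by (simp add: mult_ac)
  qed
next
  case (insert d D)
  let ?p = "\<lambda>xs. prod_list (map Var xs) * ((\<Prod>x\<in>B. Var x) * (\<Prod>y\<in>D. 1 - Var y) * a)"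
  have "derivable S F (?p xs - ?p (d # xs))"
    using insert by (intro derivable_diff insert.IH) auto
  then show ?case using insert by (simp add: algebra_simps)
qed

theorem refutation_exists:
  assumes "is_cnf F" "unsatisfiable F"
  shows "\<exists>Cs :: 'a::field mpoly set list. refutation S F Cs"
proof -
  define V where "V = cnf_vars F"
  have fin: "finite V"
    using assms(1) unfolding V_def is_cnf_def cnf_vars_def by fastforce
  let ?q = "\<lambda>A. (\<Prod>x\<in>A. Var x) * (\<Prod>y\<in>V - A. 1 - Var y) :: 'a mpoly"
  have q: "derivable S F (?q A)" if A: "A \<subseteq> V" for A
  proof -
    obtain P N where c: "(P, N) \<in> F" "P \<inter> A = {}" "N \<subseteq> A"
    proof -
      have "\<not> satisfies (\<lambda>x. x \<in> A) F"
        using assms(2) by (simp add: unsatisfiable_def)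
      then show ?thesis
        using that unfolding satisfies_def by fast
    qed
    have sub: "P \<subseteq> V" "N \<subseteq> V" using c(1) unfolding V_def cnf_vars_def by auto
    have finA: "finite A" using A fin finite_subset by blast
    have "clause_poly (P, N) \<in> (axioms_of F :: 'a mpoly set)"
      using c(1) by (simp add: axioms_of_def del: clause_poly.simps)
    from derivable_cube[OF this, of "A - N" "V - A - P" "[]" S]
    have "derivable S F ((\<Prod>x\<in>A - N. Var x) * (\<Prod>y\<in>V - A - P. 1 - Var y) * (clause_poly (P, N) :: 'a mpoly))"
      using A fin finA by (auto simp: V_def)
    moreover have "(\<Prod>x\<in>A. Var x :: 'a mpoly) = (\<Prod>x\<in>A - N. Var x) * (\<Prod>x\<in>N. Var x)"
      using c finA by (intro prod.subset_diff) auto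
    moreover have "(\<Prod>y\<in>V - A. 1 - Var y :: 'a mpoly) = (\<Prod>y\<in>V - A - P. 1 - Var y) * (\<Prod>y\<in>P. 1 - Var y)"
      using c sub fin by (intro prod.subset_diff) auto
    ultimately show ?thesis by (simp add: mult_ac)
  qed
  have "1 = (\<Prod>x\<in>V. Var x + (1 - Var x) :: 'a mpoly)" by simp
  also have "\<dots> = (\<Sum>A\<in>Pow V. ?q A)" using fin by (rule prod_add)
  finally have "1 = (\<Sum>A\<in>Pow V. ?q A)" .
  moreover have "derivable S F (\<Sum>A\<in>Pow V. ?q A)"
    using fin q by (intro derivable_sum) auto
  ultimately have "derivable S F (1 :: 'a mpoly)" by simp
  then obtain D where D: "(step S F)\<^sup>*\<^sup>* {} D" "finite D" "(1 :: 'a mpoly) \<in> D"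
    using derivable_reach by blast
  have "(step S F)\<^sup>*\<^sup>* ({1} \<union> (D - {1})) {1}"
    using D by (intro reach_erase) auto
  moreover have "{1} \<union> (D - {1}) = D" using D by auto
  ultimately have "(step S F)\<^sup>*\<^sup>* {} {1 :: 'a mpoly}"
    using D(1) by (metis rtranclp_trans)
  then show ?thesis unfolding refutation_def by (rule reach_list)
qed

end

theory Submission
  imports Defs "HOL-Library.Countable" "HOL-Library.Sublist" "HOL-Real_Asymp.Real_Asymp"
begin

text \<open>
  The formulas are pebbling formulas of recursively built graphs. A Horn clause is encoded by a
  difference of two monomials, so a Monomial Calculus refutation only moves between variable sets
  by adding or removing the head of a clause whose body is present, and may in addition enlarge
  refuted sets. Read backwards this is a black pebbling, so the variable space of MC is at least
  the black pebbling price. A module of level \<open>k + 1\<close> passes \<open>p\<close> pebbles through a line of \<open>q\<close>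
  modules of level \<open>k\<close>; each stage uses both the input layer of its submodule and a vertex that
  depends on the output layer. With \<open>q\<close> of order \<open>p\<^sup>2\<close>, a black pebbling must at some moment keep \<open>p\<close>
  pebbles on the line while it pebbles a fresh submodule from scratch, and this costs \<open>p\<close> pebbles
  per level. Polynomial Calculus instead keeps the implication between the two vertices of a stage
  while it pushes the input layer through the submodule, which costs two variables per level.
\<close>

section \<open>Monomial Calculus and black pebbling\<close>

lemma keys_plus_nat: "Poly_Mapping.keys (a + b :: 'k \<Rightarrow>\<^sub>0 nat) = Poly_Mapping.keys a \<union> Poly_Mapping.keys b"
  by (auto simp: in_keys_iff lookup_add)

lemma monomial_mult: "monomial a * monomial b = (monomial (a + b) :: 'a::field mpoly)"
  by (simp add: monomial_def mult_single)

lemma keys_monomial [simp]: "Poly_Mapping.keys (monomial m :: 'a::field mpoly) = {m}"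
  by (simp add: monomial_def)

lemma monomial_0 [simp]: "monomial 0 = (1 :: 'a::field mpoly)"
  by (simp add: monomial_def)

lemma poly_vars_monomial [simp]: "poly_vars (monomial m :: 'a::field mpoly) = Poly_Mapping.keys m"
  by (simp add: poly_vars_def)

lemma finite_poly_vars [simp]: "finite (poly_vars p)"
  by (simp add: poly_vars_def)

lemma prod_Var_eq_monomial:
  assumes "finite B"
  obtains m where "(\<Prod>y\<in>B. Var y) = (monomial m :: 'a::field mpoly)" "Poly_Mapping.keys m = B"
  using assms
proof (induction B arbitrary: thesis rule: finite_induct)
  case empty
  show ?case by (rule empty[of 0]) auto
next
  case (insert x B)
  obtain m where m: "(\<Prod>y\<in>B. Var y) = (monomial m :: 'a mpoly)" "Poly_Mapping.keys m = B"
    by (rule insert.IH)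
  show ?case
    by (rule insert.prems[of "Poly_Mapping.single x 1 + m"])
      (use insert.hyps m in \<open>auto simp: Var_def monomial_mult keys_plus_nat\<close>)
qed

text \<open>Summing coefficients by the variable sets of the power products is insensitive to exponents,
  so that Boolean axioms are mapped to 0.\<close>

definition support_sum :: "nat set set \<Rightarrow> 'a::field mpoly \<Rightarrow> 'a" where
  "support_sum X p =
     (\<Sum>m\<in>Poly_Mapping.keys p. if Poly_Mapping.keys m \<in> X then Poly_Mapping.lookup p m else 0)"

lemma support_sum_monomial [simp]:
  "support_sum X (monomial m) = (if Poly_Mapping.keys m \<in> X then 1 else 0)"
  by (simp add: support_sum_def) (simp add: monomial_def)

lemma support_sum_add: "support_sum X (p + q) = support_sum X p + support_sum X q"
  unfolding support_sum_def
  by (rule setsum_keys_plus_distrib[where f = "\<lambda>m c. if Poly_Mapping.keys m \<in> X then c else 0"]) auto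

lemma lookup_Const_mult: "Poly_Mapping.lookup (Const c * p) m = c * Poly_Mapping.lookup p m"
  unfolding Const_def mult_map_scale_conv_mult[symmetric] by (auto simp: map.rep_eq when_def)

lemma support_sum_Const_mult: "support_sum X (Const c * p) = c * support_sum X p"
proof -
  have "support_sum X (Const c * p) =
      (\<Sum>m\<in>Poly_Mapping.keys p. if Poly_Mapping.keys m \<in> X then c * Poly_Mapping.lookup p m else 0)"
    unfolding support_sum_def
    by (intro sum.mono_neutral_cong_left) (auto simp: in_keys_iff lookup_Const_mult)
  then show ?thesis
    by (simp add: support_sum_def sum_distrib_left if_distrib cong: if_cong)
qed

lemma support_sum_diff: "support_sum X (p - q) = support_sum X p - support_sum X q"
  using support_sum_add[of X p "Const (- 1) * q"] support_sum_Const_mult[of X "- 1" q]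
  by (simp add: Const_uminus)

section \<open>Pebbling moves on variable sets and the invariant of MC\<close>

definition pebble_move :: "cnf \<Rightarrow> nat \<Rightarrow> nat set \<Rightarrow> nat set \<Rightarrow> bool" where
  "pebble_move F s Q R \<longleftrightarrow> finite R \<and> card R \<le> s \<and>
     ((\<exists>x. R = Q - {x}) \<or> (\<exists>z B. ({z}, B) \<in> F \<and> B \<subseteq> Q \<and> R = insert z Q))"

text \<open>Read in reverse, the moves turn a multiple of a goal clause into the monomial with
  variable set \<open>Q\<close>, so these are the variable sets whose monomials are expected to be
  derivable in space \<open>s\<close>.\<close>

definition refuted :: "cnf \<Rightarrow> nat \<Rightarrow> nat set \<Rightarrow> bool" where
  "refuted F s Q \<longleftrightarrow> (\<exists>R N. (pebble_move F s)\<^sup>*\<^sup>* Q R \<and> ({}, N) \<in> F \<and> N \<subseteq> R)"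

text \<open>The support sum over this family will vanish on every polynomial of an MC refutation in
  variable space \<open>s\<close>. It does not vanish on 1 if the empty set is a member.\<close>

definition unrefuted :: "cnf \<Rightarrow> nat \<Rightarrow> nat set set" where
  "unrefuted F s = {Q. finite Q \<and> card Q \<le> s \<and> \<not> refuted F s Q}"

definition horn :: "cnf \<Rightarrow> bool" where
  "horn F \<longleftrightarrow> (\<forall>(P, N)\<in>F. finite N \<and> (P = {} \<or> (\<exists>z. P = {z})))"

lemma refuted_move: "pebble_move F s Q R \<Longrightarrow> refuted F s R \<Longrightarrow> refuted F s Q"
  unfolding refuted_def by (meson converse_rtranclp_into_rtranclp)

text \<open>While the body is present, the head can be placed and removed again, so each of the two
  sets reaches the other and both are refuted or neither is.\<close>

lemma unrefuted_insert:
  assumes "({z}, B) \<in> F" "B \<subseteq> Q" "finite Q" "card (insert z Q) \<le> s"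
  shows "insert z Q \<in> unrefuted F s \<longleftrightarrow> Q \<in> unrefuted F s"
proof (cases "z \<in> Q")
  case True
  then show ?thesis by (simp add: insert_absorb)
next
  case False
  then have "card Q \<le> s" using assms by simp
  then have "pebble_move F s Q (insert z Q)" "pebble_move F s (insert z Q) Q"
    using assms False unfolding pebble_move_def by (auto intro!: exI[of _ z] exI[of _ B])
  then show ?thesis
    using assms \<open>card Q \<le> s\<close> refuted_move unfolding unrefuted_def by auto
qed

text \<open>A multiple of a goal clause is a monomial with refuted support. Multiples of the other
  axioms are differences of two monomials whose supports are related by one reversible move, or are
  equal in the Boolean case, so the two contributions cancel.\<close>

lemma support_sum_axiom:
  assumes "horn F" "a \<in> axioms_of F" "card (poly_vars (monomial m * a)) \<le> s"
  shows "support_sum (unrefuted F s) (monomial m * a :: 'a::field mpoly) = 0"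
proof -
  consider P N where "(P, N) \<in> F" "a = clause_poly (P, N)" | x where "a = Var x ^ 2 - Var x"
    using assms(2) by (auto simp: axioms_of_def)
  then show ?thesis
  proof cases
    case (1 P N)
    then have "finite N" "P = {} \<or> (\<exists>z. P = {z})" using assms(1) by (auto simp: horn_def)
    obtain n where n: "(\<Prod>y\<in>N. Var y) = (monomial n :: 'a mpoly)" "Poly_Mapping.keys n = N"
      using prod_Var_eq_monomial \<open>finite N\<close> by blast
    from \<open>P = {} \<or> (\<exists>z. P = {z})\<close> show ?thesis
    proof
      assume "P = {}"
      then have eq: "monomial m * a = monomial (m + n)"
        using 1 n by (simp add: monomial_mult)
      \<comment> \<open>The support already contains the goal clause, so no move is made.\<close>
      have "refuted F s (Poly_Mapping.keys (m + n))"
        unfolding refuted_def using 1 \<open>P = {}\<close> n by (intro exI[of _ "Poly_Mapping.keys (m + n)"] exI[of _ N]) (auto simp: keys_plus_nat)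
      then show ?thesis by (simp add: eq unrefuted_def)
    next
      assume "\<exists>z. P = {z}"
      then obtain z where z: "P = {z}" by blast
      let ?l = "m + n" and ?r = "Poly_Mapping.single z 1 + (m + n)"
      have "a = monomial n - Var z * monomial n"
        using 1 n z by (simp add: left_diff_distrib)
      then have eq: "monomial m * a = monomial ?l - monomial ?r"
        by (simp add: Var_def monomial_mult right_diff_distrib ac_simps)
      have r: "Poly_Mapping.keys ?r = insert z (Poly_Mapping.keys ?l)"
        by (simp add: keys_plus_nat)
      have "Poly_Mapping.keys ?r \<in> unrefuted F s \<longleftrightarrow> Poly_Mapping.keys ?l \<in> unrefuted F s"
      proof (cases "z \<in> Poly_Mapping.keys ?l")
        case True
        then show ?thesis using r by (simp add: insert_absorb)
      next
        case False
        \<comment> \<open>Distinct monomials do not cancel, so the larger support occurs in the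
          polynomial and obeys the space bound.\<close>
        then have "?l \<noteq> ?r" using r by auto
        then have "?r \<in> Poly_Mapping.keys (monomial m * a)"
          unfolding eq by (simp add: in_keys_iff lookup_minus monomial_def lookup_single)
        then have "Poly_Mapping.keys ?r \<subseteq> poly_vars (monomial m * a)"
          unfolding poly_vars_def by blast
        then have "card (Poly_Mapping.keys ?r) \<le> s"
          using assms(3) card_mono[OF finite_poly_vars] le_trans by blast
        then show ?thesis
          unfolding r using 1 z n by (intro unrefuted_insert[of _ N]) (auto simp: keys_plus_nat)
      qed
      then show ?thesis by (simp add: eq support_sum_diff)
    qed
  next
    case (2 x)
    then have "monomial m * a =
        monomial (Poly_Mapping.single x 1 + (Poly_Mapping.single x 1 + m)) - monomial (Poly_Mapping.single x 1 + m)"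
      by (simp add: Var_def power2_eq_square right_diff_distrib monomial_mult ac_simps)
    then show ?thesis by (simp add: support_sum_diff keys_plus_nat)
  qed
qed

text \<open>Linear combinations are covered by linearity and multiples of axioms by
  \<open>support_sum_axiom\<close>. A multiplied monomial goes from a refuted support to a larger
  one, which is refuted by first removing the new variable; this monotonicity argument is specific
  to single monomials.\<close>

lemma support_sum_MC_step:
  assumes "horn F" "step MC F C D"
    and C: "\<And>p. p \<in> C \<Longrightarrow> support_sum (unrefuted F s) (p :: 'a::field mpoly) = 0"
    and D: "\<And>p. p \<in> D \<Longrightarrow> card (poly_vars p) \<le> s"
    and "p \<in> D"
  shows "support_sum (unrefuted F s) p = 0"
proof (cases "p \<in> C")
  case False
  then consider "p \<in> axioms_of F" | "infers MC F C p"
    using assms(2,5) by (auto elim!: step.cases)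
  then show ?thesis
  proof cases
    case 1
    then show ?thesis
      using support_sum_axiom[OF assms(1) 1, of 0 s] D[OF assms(5)] by simp
  next
    case 2
    then show ?thesis
    proof cases
      case (lin_comb p1 p2 \<alpha> \<beta>)
      then show ?thesis by (simp add: support_sum_add support_sum_Const_mult C)
    next
      case (multiply p1 x)
      from multiply(3) consider m where "p1 = monomial m"
        | m a where "a \<in> axioms_of F" "p1 = monomial m * a" by auto
      then show ?thesis
      proof cases
        case (1 m)
        let ?Q = "Poly_Mapping.keys m"
        have eq: "p = monomial (Poly_Mapping.single x 1 + m)"
          using 1 multiply by (simp add: Var_def monomial_mult)
        have "?Q \<notin> unrefuted F s"
          using C[OF multiply(2)] 1 by (auto split: if_splits)
        moreover have "card (insert x ?Q) \<le> s"
          using D[OF assms(5)] by (simp add: eq keys_plus_nat)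
        moreover have "card ?Q \<le> s"
          using calculation(2) card_insert_le[of ?Q x] by linarith
        ultimately have "refuted F s ?Q" by (simp add: unrefuted_def)
        have "refuted F s (insert x ?Q)"
        proof (cases "x \<in> ?Q")
          case False
          then have "pebble_move F s (insert x ?Q) ?Q"
            using \<open>card ?Q \<le> s\<close> by (auto simp: pebble_move_def intro!: exI[of _ x])
          then show ?thesis using \<open>refuted F s ?Q\<close> refuted_move by blast
        qed (use \<open>refuted F s ?Q\<close> in \<open>simp add: insert_absorb\<close>)
        then show ?thesis by (simp add: eq unrefuted_def keys_plus_nat)
      next
        case (2 m a)
        then have "p = monomial (Poly_Mapping.single x 1 + m) * a"
          using multiply by (simp add: Var_def monomial_mult flip: mult.assoc)
        then show ?thesis
          using support_sum_axiom[OF assms(1) 2(1), of "Poly_Mapping.single x 1 + m" s] D[OF assms(5)]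
          by simp
      qed
    qed
  qed
qed (rule C)

lemma step_finite: "step S F C D \<Longrightarrow> finite C \<Longrightarrow> finite D"
  by (auto elim!: step.cases)

lemma refutation_finite:
  assumes "refutation S F Cs" "i < length Cs"
  shows "finite (Cs ! i)"
  using assms(2)
proof (induction i)
  case 0
  then show ?case using assms(1) by (simp add: refutation_def hd_conv_nth)
next
  case (Suc i)
  then show ?case using assms(1) step_finite by (fastforce simp: refutation_def)
qed

lemma variable_space_le_iff:
  assumes "Cs \<noteq> []"
  shows "variable_space Cs \<le> s \<longleftrightarrow> (\<forall>C\<in>set Cs. card (\<Union>p\<in>C. poly_vars p) \<le> s)"
  using assms by (simp add: variable_space_def)

text \<open>The invariant propagates to the final polynomial 1, whose support is empty, so the empty
  set cannot be unrefuted.\<close>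

lemma MC_refutation_refuted:
  fixes Cs :: "'a::field mpoly set list"
  assumes "refutation MC F Cs" "horn F"
  shows "refuted F (variable_space Cs) {}"
proof -
  define s where "s = variable_space Cs"
  have ne: "Cs \<noteq> []" using assms by (simp add: refutation_def)
  have small: "card (poly_vars p) \<le> s" if i: "i < length Cs" and "p \<in> Cs ! i" for p i
  proof -
    have "card (\<Union>p\<in>Cs ! i. poly_vars p) \<le> s"
      using variable_space_le_iff[OF ne, of s] i by (auto simp: s_def)
    moreover have "card (poly_vars p) \<le> card (\<Union>p\<in>Cs ! i. poly_vars p)"
      using refutation_finite[OF assms(1) i] that by (intro card_mono) auto
    ultimately show ?thesis by simp
  qed
  have "support_sum (unrefuted F s) p = 0" if "i < length Cs" "p \<in> Cs ! i" for i p
    using that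
  proof (induction i arbitrary: p)
    case 0
    then show ?case using assms(1) by (simp add: refutation_def hd_conv_nth)
  next
    case (Suc i)
    then have "step MC F (Cs ! i) (Cs ! Suc i)" using assms(1) by (simp add: refutation_def)
    from support_sum_MC_step[OF assms(2) this Suc.IH small[OF Suc.prems(1)] Suc.prems(2)]
    show ?case using Suc.prems by simp
  qed
  from this[of "length Cs - 1" 1] have "support_sum (unrefuted F s) (monomial 0 :: 'a mpoly) = 0"
    using assms(1) ne by (simp add: refutation_def last_conv_nth)
  then have "{} \<notin> unrefuted F s"
    unfolding support_sum_monomial by (auto split: if_splits)
  then show ?thesis by (simp add: unrefuted_def s_def)
qed

section \<open>Pebbling formulas and black pebblings indexed by time\<close>

definition pebbling_cnf :: "('v::countable \<Rightarrow> 'v set) \<Rightarrow> 'v set \<Rightarrow> 'v set \<Rightarrow> cnf" where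
  "pebbling_cnf pred U T = insert ({}, to_nat ` T) ((\<lambda>v. ({to_nat v}, to_nat ` pred v)) ` U)"

text \<open>Only placements are constrained. Removals are free and the configuration may stand
  still, so a finite pebbling extends to all times.\<close>

locale black_pebbling =
  fixes pred :: "'v \<Rightarrow> 'v set" and C :: "nat \<Rightarrow> 'v set"
  assumes placed: "v \<in> C (Suc t) \<Longrightarrow> v \<notin> C t \<Longrightarrow> pred v \<subseteq> C t"
    and finite_C [simp]: "finite (C t)"
begin

text \<open>Take \<open>c\<close> to be the last time up to \<open>b\<close> at which
  \<open>v\<close> is empty: \<open>v\<close> is placed in the next step and then stays.\<close>

lemma last_placement:
  assumes "v \<notin> C a" "v \<in> C b" "a \<le> b"
  shows "\<exists>c\<ge>a. c < b \<and> pred v \<subseteq> C c \<and> (\<forall>t. c < t \<longrightarrow> t \<le> b \<longrightarrow> v \<in> C t)"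
proof -
  define c where "c = (GREATEST t. t \<le> b \<and> v \<notin> C t)"
  have c: "c \<le> b \<and> v \<notin> C c"
    using GreatestI_nat[of "\<lambda>t. t \<le> b \<and> v \<notin> C t" a b] assms by (simp add: c_def)
  have max: "t \<le> c" if "t \<le> b" "v \<notin> C t" for t
    using Greatest_le_nat[of "\<lambda>t. t \<le> b \<and> v \<notin> C t" t b] that by (simp add: c_def)
  have "c < b" using c assms by (cases "c = b") auto
  moreover have "v \<in> C (Suc c)" using max[of "Suc c"] \<open>c < b\<close> by auto
  moreover have "a \<le> c" using max[of a] assms by auto
  moreover have "v \<in> C t" if "c < t" "t \<le> b" for t using max[of t] that by force
  ultimately show ?thesis
    using c placed[of v c] by blast
qed

lemma placement:
  assumes "v \<notin> C a" "v \<in> C b" "a \<le> b"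
  shows "\<exists>c\<ge>a. c < b \<and> pred v \<subseteq> C c"
  using last_placement[OF assms] by blast

text \<open>Pigeonhole. A shortage of pebbles inside \<open>T\<close> leaves a vertex that has to be
  placed later.\<close>

lemma missing:
  assumes "card (C a \<inter> T) < card S" "S \<subseteq> T"
  shows "\<exists>v\<in>S. v \<notin> C a"
  using assms card_mono[of "C a \<inter> T" S] by (force simp: not_less)

end

theorem MC_refutation_black_pebbling:
  fixes Cs :: "'a::field mpoly set list" and pred :: "'v::countable \<Rightarrow> 'v set"
  assumes "refutation MC (pebbling_cnf pred U T) Cs" "finite T" "\<And>v. v \<in> U \<Longrightarrow> finite (pred v)"
  obtains C n where "black_pebbling pred C" "C 0 = {}" "T \<subseteq> C n"
    "\<And>t. card (C t) \<le> variable_space Cs"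
proof -
  let ?F = "pebbling_cnf pred U T" and ?s = "variable_space Cs"
  have "horn ?F" using assms by (auto simp: horn_def pebbling_cnf_def)
  then have "refuted ?F ?s {}" using MC_refutation_refuted assms(1) by blast
  then obtain R where R: "(pebble_move ?F ?s)\<^sup>*\<^sup>* {} R" "to_nat ` T \<subseteq> R"
    by (auto simp: refuted_def pebbling_cnf_def)
  then obtain f n where f: "f 0 = {}" "f n = R" "\<And>i. i < n \<Longrightarrow> pebble_move ?F ?s (f i) (f (Suc i))"
    by (metis rtranclp_imp_relpowp relpowp_fun_conv)
  \<comment> \<open>The preimage decodes variables into vertices, and \<open>min\<close> freezes the
    pebbling at time \<open>n\<close>.\<close>
  define C where "C t = (to_nat -` f (min t n) :: 'v set)" for t
  have fin: "finite (f i) \<and> card (f i) \<le> ?s" if "i \<le> n" for i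
    using f(1) f(3)[of "i - 1"] that by (cases i) (auto simp: pebble_move_def)
  have "finite (C t)" for t
    unfolding C_def using fin[of "min t n"] by (intro finite_vimageI) auto
  moreover have "pred v \<subseteq> C t" if v: "v \<in> C (Suc t)" "v \<notin> C t" for v t
  proof -
    have "t < n" using v by (cases "t < n") (auto simp: C_def)
    then have mv: "pebble_move ?F ?s (f t) (f (Suc t))" "to_nat v \<in> f (Suc t)" "to_nat v \<notin> f t"
      using f(3) v by (auto simp: C_def min_def not_le split: if_splits)
    then obtain z B where "({z}, B) \<in> ?F" "B \<subseteq> f t" "f (Suc t) = insert z (f t)"
      by (auto simp: pebble_move_def)
    then have "to_nat ` pred v \<subseteq> f t"
      using mv by (auto simp: pebbling_cnf_def)
    then show ?thesis using \<open>t < n\<close> by (auto simp: C_def)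
  qed
  moreover have "C 0 = {}" using f by (simp add: C_def)
  moreover have "T \<subseteq> C n" using R f by (auto simp: C_def)
  moreover have "card (C t) \<le> ?s" for t
  proof -
    have "card (C t) = card (to_nat ` C t)" by (simp add: card_image)
    also have "\<dots> \<le> card (f (min t n))"
      using fin[of "min t n"] by (intro card_mono) (auto simp: C_def)
    finally show ?thesis using fin[of "min t n"] by auto
  qed
  ultimately show ?thesis using that[of C n] by (simp add: black_pebbling_def)
qed

section \<open>Polynomial Calculus in bounded variable space\<close>

lemma poly_vars_lin_comb: "poly_vars (Const a * p + Const b * q) \<subseteq> poly_vars p \<union> poly_vars q"
  by (fastforce simp: poly_vars_def in_keys_iff lookup_add lookup_Const_mult)

lemma poly_vars_Var_mult: "poly_vars (Var x * p) \<subseteq> insert x (poly_vars p)"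
  using keys_mult[of "Var x" p] by (fastforce simp: poly_vars_def Var_def monomial_def keys_plus_nat)

lemma poly_vars_mult: "poly_vars (p * q) \<subseteq> poly_vars p \<union> poly_vars q"
  using keys_mult[of p q] by (fastforce simp: poly_vars_def keys_plus_nat)

lemma poly_vars_1 [simp]: "poly_vars 1 = {}"
  by (simp add: poly_vars_def)

lemma poly_vars_Var [simp]: "poly_vars (Var x) = {x}"
  by (simp add: poly_vars_def Var_def monomial_def)

lemma poly_vars_diff: "poly_vars (p - q) \<subseteq> poly_vars p \<union> poly_vars q"
  by (fastforce simp: poly_vars_def in_keys_iff lookup_minus)

lemma poly_vars_prod: "finite B \<Longrightarrow> poly_vars (\<Prod>b\<in>B. f b) \<subseteq> (\<Union>b\<in>B. poly_vars (f b))"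
  by (induction B rule: finite_induct) (use poly_vars_mult in fastforce)+

text \<open>If the polynomials of \<open>C\<close> also use only variables of \<open>X\<close>, all
  lines of such a derivation can be stored together in variable space \<open>card X\<close>.\<close>

inductive PC_derives :: "cnf \<Rightarrow> nat set \<Rightarrow> 'a::field mpoly set \<Rightarrow> 'a mpoly \<Rightarrow> bool" for F X C where
  hyp: "p \<in> C \<Longrightarrow> PC_derives F X C p"
| ax: "a \<in> axioms_of F \<Longrightarrow> poly_vars a \<subseteq> X \<Longrightarrow> PC_derives F X C a"
| lin: "PC_derives F X C p \<Longrightarrow> PC_derives F X C q \<Longrightarrow> PC_derives F X C (Const \<alpha> * p + Const \<beta> * q)"
| mul: "PC_derives F X C p \<Longrightarrow> x \<in> X \<Longrightarrow> PC_derives F X C (Var x * p)"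

lemma PC_derives_diff: "PC_derives F X C p \<Longrightarrow> PC_derives F X C q \<Longrightarrow> PC_derives F X C (p - q)"
  using PC_derives.lin[of F X C p q 1 "- 1"] by (simp add: Const_uminus)

lemma PC_derives_add: "PC_derives F X C p \<Longrightarrow> PC_derives F X C q \<Longrightarrow> PC_derives F X C (p + q)"
  using PC_derives.lin[of F X C p q 1 1] by simp

lemma PC_derives_mult_one_minus_Var:
  "PC_derives F X C p \<Longrightarrow> x \<in> X \<Longrightarrow> PC_derives F X C ((1 - Var x) * p)"
  using PC_derives_diff[OF _ PC_derives.mul, of F X C p p x] by (simp add: left_diff_distrib)

text \<open>Resolving a unit clause away needs the multiplication of a derived polynomial that is not
  a monomial, which is the step unavailable to MC.\<close>

definition closed_multiplier :: "cnf \<Rightarrow> nat set \<Rightarrow> 'a::field mpoly \<Rightarrow> bool" where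
  "closed_multiplier F X r \<longleftrightarrow> (\<forall>C p. PC_derives F X C p \<longrightarrow> PC_derives F X C (r * p))"

lemma closed_multiplier_intros:
  "closed_multiplier F X 1"
  "x \<in> X \<Longrightarrow> closed_multiplier F X (1 - Var x)"
  "x \<in> X \<Longrightarrow> closed_multiplier F X r \<Longrightarrow> closed_multiplier F X (Var x * r)"
  unfolding closed_multiplier_def mult.assoc
  by (simp, blast intro: PC_derives_mult_one_minus_Var, blast intro: PC_derives.mul)

text \<open>Variables are removed one at a time by \<open>Var b * r + r * (1 - Var b) = r\<close>.
  The second summand multiplies a derived fact by \<open>r\<close>, hence the condition on
  \<open>r\<close>.\<close>

lemma PC_derives_resolve:
  assumes "finite B" "B \<subseteq> X" "PC_derives F X C ((\<Prod>b\<in>B. Var b) * r)" "closed_multiplier F X r"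
    and "\<And>b. b \<in> B \<Longrightarrow> PC_derives F X C (1 - Var b)"
  shows "PC_derives F X C r"
  using assms
proof (induction B arbitrary: r rule: finite_induct)
  case (insert b B)
  have "(\<Prod>b\<in>insert b B. Var b) * r = (\<Prod>b\<in>B. Var b) * (Var b * r)"
    using insert.hyps by (simp add: mult_ac)
  with insert.prems(2) have "PC_derives F X C ((\<Prod>b\<in>B. Var b) * (Var b * r))"
    by (simp only:)
  \<comment> \<open>The variable \<open>b\<close> is absorbed into the multiplier before the
    induction hypothesis is applied.\<close>
  then have "PC_derives F X C (Var b * r)"
    by (rule insert.IH[rotated]) (use insert.prems in \<open>auto intro!: closed_multiplier_intros(3)\<close>)
  moreover have "PC_derives F X C (r * (1 - Var b))"
    using insert.prems(3) insert.prems(4)[of b] unfolding closed_multiplier_def by blast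
  ultimately have "PC_derives F X C (Var b * r + r * (1 - Var b))"
    by (rule PC_derives_add)
  then show ?case by (simp add: algebra_simps)
qed simp

definition bounded_step :: "cnf \<Rightarrow> nat \<Rightarrow> 'a::field mpoly set \<Rightarrow> 'a mpoly set \<Rightarrow> bool" where
  "bounded_step F s C D \<longleftrightarrow> step PC F C D \<and> card (\<Union>p\<in>D. poly_vars p) \<le> s"

abbreviation bounded_reach :: "cnf \<Rightarrow> nat \<Rightarrow> 'a::field mpoly set \<Rightarrow> 'a mpoly set \<Rightarrow> bool" where
  "bounded_reach F s \<equiv> (bounded_step F s)\<^sup>*\<^sup>*"

lemma bounded_stepI:
  assumes "step PC F C D" "\<And>p. p \<in> D \<Longrightarrow> poly_vars p \<subseteq> X" "finite X" "card X \<le> s"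
  shows "bounded_step F s C D"
proof -
  have "card (\<Union>p\<in>D. poly_vars p) \<le> card X"
    using assms by (intro card_mono) auto
  then show ?thesis using assms by (simp add: bounded_step_def)
qed

text \<open>Nothing is erased along the way: accumulating polynomials over \<open>X\<close> does not
  increase the variable space beyond \<open>card X\<close>.\<close>

lemma bounded_reach_derived:
  assumes "PC_derives F X C p" "finite X" "card X \<le> s" "X \<subseteq> cnf_vars F"
    and "finite D" "C \<subseteq> D" "\<And>p. p \<in> D \<Longrightarrow> poly_vars p \<subseteq> X"
  shows "\<exists>E. bounded_reach F s D E \<and> finite E \<and> D \<subseteq> E \<and> p \<in> E \<and> (\<forall>p\<in>E. poly_vars p \<subseteq> X)"
  using assms(1,5-)
proof (induction arbitrary: D)
  case (hyp p)
  then show ?case by (intro exI[of _ D]) auto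
next
  case (ax a)
  have "bounded_step F s D (insert a D)"
    using ax assms by (intro bounded_stepI[of _ _ _ X] step.download) auto
  then show ?case using ax by (intro exI[of _ "insert a D"]) auto
next
  case (lin p q \<alpha> \<beta>)
  obtain D1 where D1: "bounded_reach F s D D1" "finite D1" "D \<subseteq> D1" "p \<in> D1" "\<forall>p\<in>D1. poly_vars p \<subseteq> X"
    using lin.IH(1)[OF lin.prems] by blast
  obtain D2 where D2: "bounded_reach F s D1 D2" "finite D2" "D1 \<subseteq> D2" "q \<in> D2" "\<forall>p\<in>D2. poly_vars p \<subseteq> X"
    using lin.IH(2)[OF D1(2) subset_trans[OF lin.prems(2) D1(3)] bspec[OF D1(5)]] by blast
  let ?r = "Const \<alpha> * p + Const \<beta> * q"
  have r: "poly_vars ?r \<subseteq> X"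
    using poly_vars_lin_comb[of \<alpha> p \<beta> q] D1 D2 by blast
  have "bounded_step F s D2 (insert ?r D2)"
    using D1 D2 r assms by (intro bounded_stepI[of _ _ _ X] step.infer infers.lin_comb) auto
  then have "bounded_reach F s D (insert ?r D2)"
    using D1(1) D2(1) by (meson rtranclp.rtrancl_into_rtrancl rtranclp_trans)
  then show ?case using D1 D2 r by (intro exI[of _ "insert ?r D2"]) auto
next
  case (mul p x)
  obtain D1 where D1: "bounded_reach F s D D1" "finite D1" "D \<subseteq> D1" "p \<in> D1" "\<forall>p\<in>D1. poly_vars p \<subseteq> X"
    using mul.IH[OF mul.prems] by blast
  have r: "poly_vars (Var x * p) \<subseteq> X"
    using poly_vars_Var_mult[of x p] D1 mul by blast
  have "bounded_step F s D1 (insert (Var x * p) D1)"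
    using D1 r mul assms by (intro bounded_stepI[of _ _ _ X] step.infer infers.multiply) auto
  then have "bounded_reach F s D (insert (Var x * p) D1)"
    using D1(1) by (meson rtranclp.rtrancl_into_rtrancl)
  then show ?case using D1 r by (intro exI[of _ "insert (Var x * p) D1"]) auto
qed

lemma bounded_reach_erase:
  assumes "finite E" "\<And>p. p \<in> D \<union> E \<Longrightarrow> poly_vars p \<subseteq> X" "finite X" "card X \<le> s"
  shows "bounded_reach F s (D \<union> E) D"
  using assms(1,2)
proof (induction E rule: finite_induct)
  case (insert p E)
  show ?case
  proof (cases "p \<in> D")
    case False
    then have "D \<union> insert p E - {p} = D \<union> E" using insert by auto
    then have "step PC F (D \<union> insert p E) (D \<union> E)"
      using step.erase[of p "D \<union> insert p E" PC F] by simp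
    then have "bounded_step F s (D \<union> insert p E) (D \<union> E)"
      using insert.prems assms by (intro bounded_stepI[of _ _ _ X]) auto
    then show ?thesis using insert by (auto intro: converse_rtranclp_into_rtranclp)
  qed (use insert in \<open>simp add: insert_absorb\<close>)
qed auto

text \<open>All of \<open>Q\<close> is derived while everything is kept, and only then is the rest
  erased.\<close>

lemma bounded_reach_derives:
  assumes "finite C" "finite Q" "\<And>p. p \<in> Q \<Longrightarrow> PC_derives F X C p" "\<And>p. p \<in> C \<Longrightarrow> poly_vars p \<subseteq> X"
    and "finite X" "card X \<le> s" "X \<subseteq> cnf_vars F"
  shows "bounded_reach F s C Q"
proof -
  have "\<exists>E. bounded_reach F s C E \<and> finite E \<and> C \<subseteq> E \<and> Q \<subseteq> E \<and> (\<forall>p\<in>E. poly_vars p \<subseteq> X)"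
    using assms(2,3)
  proof (induction Q rule: finite_induct)
    case empty
    then show ?case using assms by (intro exI[of _ C]) auto
  next
    case (insert p Q)
    then obtain D where D: "bounded_reach F s C D" "finite D" "C \<subseteq> D" "Q \<subseteq> D" "\<forall>p\<in>D. poly_vars p \<subseteq> X"
      by auto
    obtain E where "bounded_reach F s D E" "finite E" "D \<subseteq> E" "p \<in> E" "\<forall>p\<in>E. poly_vars p \<subseteq> X"
      using bounded_reach_derived[OF insert.prems[of p] assms(5,6,7) D(2,3)] D(5) by blast
    then show ?case
      using D by (intro exI[of _ E]) (auto intro: rtranclp_trans)
  qed
  then obtain E where E: "bounded_reach F s C E" "finite E" "Q \<subseteq> E" "\<forall>p\<in>E. poly_vars p \<subseteq> X" by blast
  then have "Q \<union> E = E" by auto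
  then have "bounded_reach F s E Q"
    using bounded_reach_erase[of E Q X s F] E assms by simp
  then show ?thesis using E(1) by (rule rtranclp_trans[rotated])
qed

lemma VSpace_PC_le:
  assumes "bounded_reach F s {} {1 :: 'a::field mpoly}"
  shows "VSpace PC TYPE('a) F \<le> s"
proof -
  obtain f n where f: "f 0 = {}" "f n = {1 :: 'a mpoly}" "\<And>i. i < n \<Longrightarrow> bounded_step F s (f i) (f (Suc i))"
    using assms by (metis rtranclp_imp_relpowp relpowp_fun_conv)
  let ?Cs = "map f [0..<Suc n]"
  have "refutation PC F ?Cs"
    using f by (auto simp: refutation_def bounded_step_def hd_map nth_append last_map simp del: upt_Suc)
  moreover have "variable_space ?Cs \<le> s"
  proof -
    have "card (\<Union>p\<in>f i. poly_vars p) \<le> s" if "i \<le> n" for i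
      using that f(1) f(3)[of "i - 1"] by (cases i) (auto simp: bounded_step_def)
    then show ?thesis by (subst variable_space_le_iff) auto
  qed
  moreover have "VSpace PC TYPE('a) F \<le> variable_space ?Cs"
    unfolding VSpace_def by (rule Least_le) (use calculation(1) in blast)
  ultimately show ?thesis by simp
qed

section \<open>Pebbling steps simulated in PC\<close>

abbreviation fact :: "'v::countable \<Rightarrow> 'a::field mpoly" where
  "fact v \<equiv> 1 - Var (to_nat v)"

lemma poly_vars_fact: "poly_vars (fact v) \<subseteq> {to_nat v}"
  using poly_vars_diff[of 1 "Var (to_nat v)"] by simp

lemma PC_derives_pebbling_axiom:
  assumes "v \<in> U" "finite (pred v)" "to_nat ` insert v (pred v) \<subseteq> X"
  shows "PC_derives (pebbling_cnf pred U T) X C ((\<Prod>b\<in>to_nat ` pred v. Var b) * fact v)"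
proof (rule PC_derives.ax)
  have "clause_poly ({to_nat v}, to_nat ` pred v) \<in> axioms_of (pebbling_cnf pred U T)"
    using assms(1) by (auto simp: axioms_of_def pebbling_cnf_def simp del: clause_poly.simps)
  then show "(\<Prod>b\<in>to_nat ` pred v. Var b) * fact v \<in> axioms_of (pebbling_cnf pred U T)"
    by (simp add: mult.commute)
  have "poly_vars (\<Prod>b\<in>to_nat ` pred v. Var b) \<subseteq> X"
    using poly_vars_prod[of "to_nat ` pred v" Var] assms by auto
  then show "poly_vars ((\<Prod>b\<in>to_nat ` pred v. Var b) * fact v) \<subseteq> X"
    using poly_vars_mult poly_vars_fact assms(3) by blast
qed

lemma PC_derives_pebble:
  assumes "v \<in> U" "finite (pred v)" "to_nat ` insert v (pred v) \<subseteq> X"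
    and "\<And>b. b \<in> pred v \<Longrightarrow> PC_derives (pebbling_cnf pred U T) X C (fact b)"
  shows "PC_derives (pebbling_cnf pred U T) X C (fact v)"
  by (rule PC_derives_resolve[OF _ _ PC_derives_pebbling_axiom[of v U pred X, OF assms(1-3)]])
    (use assms in \<open>auto intro!: closed_multiplier_intros\<close>)

text \<open>Resolving away all predecessors except \<open>w\<close> leaves the implication from
  \<open>w\<close> to \<open>v\<close>. It mentions two variables only, so the other predecessors
  can be forgotten while it is stored.\<close>

lemma PC_derives_pebble_conditional:
  assumes "v \<in> U" "finite (pred v)" "to_nat ` insert v (pred v) \<subseteq> X" "w \<in> pred v"
    and "\<And>b. b \<in> pred v - {w} \<Longrightarrow> PC_derives (pebbling_cnf pred U T) X C (fact b)"
  shows "PC_derives (pebbling_cnf pred U T) X C (Var (to_nat w) * fact v)"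
proof (rule PC_derives_resolve)
  have "(\<Prod>b\<in>to_nat ` pred v. Var b) = Var (to_nat w) * (\<Prod>b\<in>to_nat ` (pred v - {w}). Var b :: 'b mpoly)"
    using assms(2,4) by (subst prod.remove[of _ "to_nat w"]) (auto simp: image_set_diff)
  then show "PC_derives (pebbling_cnf pred U T) X C
      ((\<Prod>b\<in>to_nat ` (pred v - {w}). Var b) * (Var (to_nat w) * fact v))"
    using PC_derives_pebbling_axiom[of v U pred X T C] assms by (simp add: mult_ac)
qed (use assms in \<open>auto intro!: closed_multiplier_intros\<close>)

section \<open>The tower graph and its black pebbling price\<close>

text \<open>
  A module is named by the list of stage indices leading to it, innermost first, so that the module
  of stage \<open>i\<close> of \<open>\<sigma>\<close> is \<open>i # \<sigma>\<close>. \<open>Done \<sigma>\<close> certifies the outputs of \<open>\<sigma>\<close>, and \<open>Link \<sigma>\<close> requires \<open>Done \<sigma>\<close>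
  together with the inputs of \<open>\<sigma>\<close>: a black pebbling has to hold or recompute these inputs.
\<close>

datatype vertex = Inp "nat list" nat | Outp "nat list" nat | Done "nat list" | Link "nat list"

instance vertex :: countable
  by countable_datatype

fun address :: "vertex \<Rightarrow> nat list" where
  "address (Inp \<sigma> j) = \<sigma>"
| "address (Outp \<sigma> j) = \<sigma>"
| "address (Done \<sigma>) = \<sigma>"
| "address (Link \<sigma>) = \<sigma>"

definition inputs :: "nat \<Rightarrow> nat list \<Rightarrow> vertex set" where
  "inputs p \<sigma> = Inp \<sigma> ` {..<p}"

definition outputs :: "nat \<Rightarrow> nat list \<Rightarrow> vertex set" where
  "outputs p \<sigma> = Outp \<sigma> ` {..<p}"

text \<open>Consecutive layers are completely joined: placing any single vertex of a layer requires
  the whole layer before it at once. Modules of depth \<open>K\<close> are the innermost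
  ones.\<close>

fun preds :: "nat \<Rightarrow> nat \<Rightarrow> nat \<Rightarrow> vertex \<Rightarrow> vertex set" where
  "preds K q p (Inp [] j) = {}"
| "preds K q p (Inp (0 # \<sigma>) j) = inputs p \<sigma>"
| "preds K q p (Inp (Suc i # \<sigma>) j) = insert (Link (i # \<sigma>)) (outputs p (i # \<sigma>))"
| "preds K q p (Outp \<sigma> j) =
     (if length \<sigma> = K then inputs p \<sigma> else insert (Link ((q - 1) # \<sigma>)) (outputs p ((q - 1) # \<sigma>)))"
| "preds K q p (Done \<sigma>) = outputs p \<sigma>"
| "preds K q p (Link \<sigma>) = insert (Done \<sigma>) (inputs p \<sigma>)"

text \<open>Addresses start with the innermost index, so nesting of modules is the suffix
  order.\<close>

definition subtree :: "nat list \<Rightarrow> vertex set" where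
  "subtree \<sigma> = {v. suffix \<sigma> (address v)}"

text \<open>The inputs of \<open>\<sigma>\<close> are left out, as are \<open>Done \<sigma>\<close>
  and \<open>Link \<sigma>\<close>. Pebbles held on the inputs thus count as lying outside, which
  \<open>stage_blocked\<close> exploits.\<close>

definition interior :: "nat list \<Rightarrow> vertex set" where
  "interior \<sigma> = {v. strict_suffix \<sigma> (address v) \<or> (\<exists>j. v = Outp \<sigma> j)}"

definition stages :: "nat list \<Rightarrow> nat \<Rightarrow> vertex set" where
  "stages \<sigma> i = (\<Union>i'\<le>i. subtree (i' # \<sigma>))"

section \<open>Nesting and disjointness of modules\<close>

lemma card_inputs [simp]: "card (inputs p \<sigma>) = p"
  and card_outputs [simp]: "card (outputs p \<sigma>) = p"
  by (simp_all add: inputs_def outputs_def card_image inj_on_def)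

lemma suffix_Cons_same: "suffix (i # \<sigma>) \<rho> \<Longrightarrow> suffix (j # \<sigma>) \<rho> \<Longrightarrow> i = j"
  by (auto simp: suffix_def)

lemma subtree_disjoint: "i \<noteq> j \<Longrightarrow> subtree (i # \<sigma>) \<inter> subtree (j # \<sigma>) = {}"
  by (auto simp: subtree_def dest: suffix_Cons_same)

lemma subtree_Cons_subset: "subtree (i # \<sigma>) \<subseteq> interior \<sigma>"
  by (auto simp: subtree_def interior_def strict_suffix_def suffix_def)

lemma interior_subset: "interior \<sigma> \<subseteq> subtree \<sigma>"
  by (auto simp: subtree_def interior_def strict_suffix_def)

lemma inputs_subset: "inputs p \<sigma> \<subseteq> subtree \<sigma>"
  by (auto simp: subtree_def inputs_def)

lemma outputs_subset: "outputs p \<sigma> \<subseteq> interior \<sigma>"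
  by (auto simp: interior_def outputs_def)

lemma outputs_subset_subtree: "outputs p \<sigma> \<subseteq> subtree \<sigma>"
  using outputs_subset interior_subset by blast

lemma subtree_subset_stages: "i' \<le> i \<Longrightarrow> subtree (i' # \<sigma>) \<subseteq> stages \<sigma> i"
  by (auto simp: stages_def)

lemma stages_mono: "i' \<le> i \<Longrightarrow> stages \<sigma> i' \<subseteq> stages \<sigma> i"
  unfolding stages_def by (intro UN_mono) auto

lemma stages_subset: "stages \<sigma> i \<subseteq> interior \<sigma>"
  using subtree_Cons_subset by (fastforce simp: stages_def)

lemma stages_disjoint: "i' < i \<Longrightarrow> stages \<sigma> i' \<inter> subtree (i # \<sigma>) = {}"
  by (auto simp: stages_def subtree_def dest: suffix_Cons_same)

lemma interior_Int_inputs: "interior \<sigma> \<inter> inputs p \<sigma> = {}"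
  by (auto simp: interior_def inputs_def)

section \<open>Forced recomputation in black pebblings of the tower\<close>

locale tower_pebbling = black_pebbling "preds K q p" C for K q p C +
  assumes p: "0 < p" and q: "p * p + p \<le> q"
begin


text \<open>Some input is empty at time \<open>a\<close> and must be placed later; all inputs of a
  module have the same predecessors.\<close>

lemma inputs_placed:
  assumes "card (C a \<inter> subtree \<sigma>) < p" "inputs p \<sigma> \<subseteq> C b" "a \<le> b"
  obtains c j where "a \<le> c" "c < b" "preds K q p (Inp \<sigma> j) \<subseteq> C c"
proof -
  have "\<exists>v\<in>inputs p \<sigma>. v \<notin> C a"
    using missing[OF _ inputs_subset, of a \<sigma> p] assms(1) by simp
  then obtain v where v: "v \<in> inputs p \<sigma>" "v \<notin> C a" by blast
  then obtain c where "a \<le> c" "c < b" "preds K q p v \<subseteq> C c"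
    using placement[of v a b] assms by blast
  then show ?thesis using v that by (auto simp: inputs_def)
qed

lemma card_subtree_Cons_le: "card (C a \<inter> subtree (i # \<sigma>)) \<le> card (C a \<inter> subtree \<sigma>)"
  using subtree_Cons_subset interior_subset by (intro card_mono) fastforce+

text \<open>The computation is traced backwards, by recursion on depth through a submodule and by
  induction along the line of stages. In every layer some vertex is missing at time
  \<open>a\<close>, so no layer can be skipped.\<close>

lemma inputs_before_outputs:
  assumes "length \<sigma> \<le> K" "card (C a \<inter> subtree \<sigma>) < p" "outputs p \<sigma> \<subseteq> C b" "a \<le> b"
  shows "\<exists>t\<ge>a. t \<le> b \<and> inputs p \<sigma> \<subseteq> C t"
  using assms
proof (induction "K - length \<sigma>" arbitrary: \<sigma> b)
  case 0
  obtain v where v: "v \<in> outputs p \<sigma>" "v \<notin> C a"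
    using missing[of a "subtree \<sigma>" "outputs p \<sigma>"] "0.prems"(2) outputs_subset_subtree by auto
  then obtain c where "a \<le> c" "c < b" "preds K q p v \<subseteq> C c"
    using placement[of v a b] "0.prems"(3,4) by auto
  then show ?case using v 0 by (intro exI[of _ c]) (auto simp: outputs_def)
next
  case (Suc k)
  have len: "k = K - length (i # \<sigma>)" "length (i # \<sigma>) \<le> K" for i
    using Suc.hyps(2) by auto
  have small: "card (C a \<inter> subtree (i # \<sigma>)) < p" for i
    using Suc.prems(2) card_subtree_Cons_le order.strict_trans1 by blast
  \<comment> \<open>The name \<open>Suc\<close> is rebound by the inner induction over
    stages.\<close>
  note outer = Suc.hyps(1)
  have *: "\<exists>t\<ge>a. t \<le> b \<and> inputs p \<sigma> \<subseteq> C t"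
    if "outputs p (i # \<sigma>) \<subseteq> C b" "a \<le> b" for i b
    using that
  proof (induction i arbitrary: b)
    case (0 b)
    obtain t where t: "a \<le> t" "t \<le> b" "inputs p (0 # \<sigma>) \<subseteq> C t"
      using Suc.hyps(1)[OF len small 0] by blast
    obtain c where "a \<le> c" "c < t" "inputs p \<sigma> \<subseteq> C c"
      using inputs_placed[OF small t(3,1)] by auto
    then show ?case using t by (intro exI[of _ c]) auto
  next
    case (Suc i b)
    obtain t where t: "a \<le> t" "t \<le> b" "inputs p (Suc i # \<sigma>) \<subseteq> C t"
      using outer[OF len small Suc.prems] by blast
    obtain c where c: "a \<le> c" "c < t" "outputs p (i # \<sigma>) \<subseteq> C c"
      using inputs_placed[OF small t(3,1)] by auto
    then obtain t' where "a \<le> t'" "t' \<le> c" "inputs p \<sigma> \<subseteq> C t'"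
      using Suc.IH[of c] by auto
    then show ?case using t c by (intro exI[of _ t']) auto
  qed
  obtain v where v: "v \<in> outputs p \<sigma>" "v \<notin> C a"
    using missing[of a "subtree \<sigma>" "outputs p \<sigma>"] Suc.prems(2) outputs_subset_subtree by auto
  then obtain c where c: "a \<le> c" "c < b" "preds K q p v \<subseteq> C c"
    using placement[of v a b] Suc.prems(3,4) by auto
  then have "outputs p ((q - 1) # \<sigma>) \<subseteq> C c"
    using v Suc.hyps(2) by (auto simp: outputs_def[of p \<sigma>] subset_iff split: if_splits)
  then show ?case using *[of "q - 1" c] c by (meson le_trans less_imp_le)
qed

text \<open>The inputs of a stage need the link and the outputs of its predecessor simultaneously;
  this is iterated back to stage \<open>i'\<close>.\<close>

lemma earlier_stage:
  assumes "length \<sigma> < K" "card (C a \<inter> stages \<sigma> i) < p" "outputs p (i # \<sigma>) \<subseteq> C b" "a \<le> b" "i' < i"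
  shows "\<exists>t\<ge>a. t \<le> b \<and> Link (i' # \<sigma>) \<in> C t \<and> outputs p (i' # \<sigma>) \<subseteq> C t"
  using assms
proof (induction i arbitrary: b)
  case (Suc i)
  have small: "card (C a \<inter> subtree (Suc i # \<sigma>)) < p"
    using Suc.prems(2) subtree_subset_stages[of "Suc i" "Suc i" \<sigma>]
    by (meson card_mono finite_C finite_Int Int_mono order.strict_trans1 order_refl)
  obtain t where t: "a \<le> t" "t \<le> b" "inputs p (Suc i # \<sigma>) \<subseteq> C t"
    using inputs_before_outputs[of "Suc i # \<sigma>" a b] Suc.prems small by auto
  obtain c where c: "a \<le> c" "c < t" "Link (i # \<sigma>) \<in> C c" "outputs p (i # \<sigma>) \<subseteq> C c"
    using inputs_placed[OF small t(3,1)] by force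
  show ?case
  proof (cases "i' = i")
    case True
    then show ?thesis using t c by (intro exI[of _ c]) auto
  next
    case False
    have "card (C a \<inter> stages \<sigma> i) < p"
      using Suc.prems(2) stages_mono[of i "Suc i" \<sigma>]
      by (meson card_mono finite_C finite_Int Int_mono order.strict_trans1 order_refl le_SucI)
    then obtain t' where "a \<le> t'" "t' \<le> c" "Link (i' # \<sigma>) \<in> C t' \<and> outputs p (i' # \<sigma>) \<subseteq> C t'"
      using Suc.IH[of c] c Suc.prems False by auto
    then show ?thesis using t c by (intro exI[of _ t']) auto
  qed
qed simp

text \<open>The last \<open>p\<close> stages up to \<open>i\<close> are disjoint, so fewer than
  \<open>p\<close> pebbles miss one of them.\<close>

lemma clean_stage:
  assumes "card (C a \<inter> stages \<sigma> i) < p" "p \<le> Suc i"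
  obtains i0 where "i0 \<le> i" "i < i0 + p" "C a \<inter> subtree (i0 # \<sigma>) = {}"
proof -
  have "\<exists>i0\<in>{Suc i - p..i}. C a \<inter> subtree (i0 # \<sigma>) = {}"
  proof (rule ccontr)
    assume "\<not> ?thesis"
    then have "\<forall>i0\<in>{Suc i - p..i}. \<exists>v. v \<in> C a \<inter> subtree (i0 # \<sigma>)" by blast
    then obtain f where f: "\<And>i0. i0 \<in> {Suc i - p..i} \<Longrightarrow> f i0 \<in> C a \<inter> subtree (i0 # \<sigma>)"
      by (metis bchoice)
    have "inj_on f {Suc i - p..i}"
    proof (rule inj_onI)
      fix x y assume "x \<in> {Suc i - p..i}" "y \<in> {Suc i - p..i}" "f x = f y"
      then have "f x \<in> subtree (x # \<sigma>) \<inter> subtree (y # \<sigma>)" using f[of x] f[of y] by auto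
      then show "x = y" using subtree_disjoint[of x y \<sigma>] by auto
    qed
    moreover have "f ` {Suc i - p..i} \<subseteq> C a \<inter> stages \<sigma> i"
      using f by (auto simp: stages_def)
    ultimately have "card {Suc i - p..i} \<le> card (C a \<inter> stages \<sigma> i)"
      by (meson card_inj_on_le finite_C finite_Int)
    then show False using assms by simp
  qed
  then show ?thesis using that assms(2) p by force
qed

text \<open>Between the times \<open>g\<close> and \<open>d\<close> the submodule of stage \<open>i0\<close> is pebbled from scratch, and its inputs
  are needed once more at the later time \<open>c\<close>, with at least one pebble in stage \<open>i0\<close> all along.\<close>

lemma stage_recomputed:
  assumes "length \<sigma> < K" "card (C a \<inter> stages \<sigma> i) < p" "Link (i # \<sigma>) \<in> C b" "outputs p (i # \<sigma>) \<subseteq> C b"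
    and "a \<le> b" "p \<le> Suc i"
  obtains i0 g d c where "i0 \<le> i" "i < i0 + p" "a \<le> g" "g < d" "d < c" "c \<le> b"
    "C g \<inter> interior (i0 # \<sigma>) = {}" "outputs p (i0 # \<sigma>) \<subseteq> C d" "inputs p (i0 # \<sigma>) \<subseteq> C c"
    "\<And>t. g < t \<Longrightarrow> t \<le> c \<Longrightarrow> C t \<inter> subtree (i0 # \<sigma>) \<noteq> {}"
proof -
  obtain i0 where i0: "i0 \<le> i" "i < i0 + p" and clean: "C a \<inter> subtree (i0 # \<sigma>) = {}"
    using clean_stage assms(2,6) by blast
  obtain b1 where b1: "a \<le> b1" "b1 \<le> b" "Link (i0 # \<sigma>) \<in> C b1"
    using earlier_stage[OF assms(1,2,4,5), of i0] i0 assms(3,5) by (cases "i0 = i") auto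
  have "Link (i0 # \<sigma>) \<notin> C a" "Done (i0 # \<sigma>) \<notin> C a"
    using clean by (auto simp: subtree_def disjoint_iff)
  \<comment> \<open>Placing the link requires \<open>Done\<close> together with the inputs, long
    after the inputs served to compute the outputs.\<close>
  obtain c where c: "a \<le> c" "c < b1" "Done (i0 # \<sigma>) \<in> C c" "inputs p (i0 # \<sigma>) \<subseteq> C c"
    using placement[OF \<open>Link (i0 # \<sigma>) \<notin> C a\<close> b1(3,1)] by auto
  obtain d where d: "a \<le> d" "d < c" "outputs p (i0 # \<sigma>) \<subseteq> C d"
      "\<And>t. d < t \<Longrightarrow> t \<le> c \<Longrightarrow> Done (i0 # \<sigma>) \<in> C t"
    using last_placement[OF \<open>Done (i0 # \<sigma>) \<notin> C a\<close> c(3,1)] by auto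
  \<comment> \<open>The last time up to \<open>d\<close> with empty interior; time \<open>a\<close>
    qualifies because the stage is clean.\<close>
  define g where "g = (GREATEST t. t \<le> d \<and> C t \<inter> interior (i0 # \<sigma>) = {})"
  have "C a \<inter> interior (i0 # \<sigma>) = {}" using clean interior_subset by blast
  then have g: "g \<le> d \<and> C g \<inter> interior (i0 # \<sigma>) = {}"
    using GreatestI_nat[of "\<lambda>t. t \<le> d \<and> C t \<inter> interior (i0 # \<sigma>) = {}" a d] d by (simp add: g_def)
  have max: "t \<le> g" if "t \<le> d" "C t \<inter> interior (i0 # \<sigma>) = {}" for t
    using Greatest_le_nat[of "\<lambda>t. t \<le> d \<and> C t \<inter> interior (i0 # \<sigma>) = {}" t d] that by (simp add: g_def)
  have "outputs p (i0 # \<sigma>) \<noteq> {}" using p by (auto simp: outputs_def)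
  then have "C d \<inter> interior (i0 # \<sigma>) \<noteq> {}" using d(3) outputs_subset by blast
  then have "g < d" using g by (cases "g = d") auto
  \<comment> \<open>Up to \<open>d\<close> the interior is occupied by maximality of
    \<open>g\<close>, and afterwards \<open>Done\<close> stays pebbled.\<close>
  moreover have "C t \<inter> subtree (i0 # \<sigma>) \<noteq> {}" if "g < t" "t \<le> c" for t
  proof (cases "t \<le> d")
    case True
    then show ?thesis using max[of t] that interior_subset[of "i0 # \<sigma>"] by auto
  next
    case False
    then have "Done (i0 # \<sigma>) \<in> C t \<inter> subtree (i0 # \<sigma>)" using d(4)[of t] that by (auto simp: subtree_def)
    then show ?thesis by blast
  qed
  moreover have "a \<le> g" using max[of a] d(1) \<open>C a \<inter> interior (i0 # \<sigma>) = {}\<close> by auto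
  ultimately show ?thesis using that[of i0 g d c] i0 g d c b1 by auto
qed

text \<open>If fewer than \<open>p\<close> pebbles remain outside at some time while the submodule is being pebbled, then
  its inputs have to be pebbled again, and induction on \<open>m\<close> applies to the earlier stages, with
  the pebble in the present stage in addition. A pebbling may save up to \<open>p\<close> stages by its remaining
  pebbles in each round, whence the bound \<open>m * p + p\<close>.\<close>

lemma stage_blocked:
  assumes "length \<sigma> < K" "card (C a \<inter> stages \<sigma> i) < p" "Link (i # \<sigma>) \<in> C b" "outputs p (i # \<sigma>) \<subseteq> C b"
    and "a \<le> b" "m \<le> p" "m * p + p \<le> Suc i"
  shows "\<exists>i'\<le>i. \<exists>a' b'. a \<le> a' \<and> a' < b' \<and> b' \<le> b \<and> C a' \<inter> interior (i' # \<sigma>) = {} \<and>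
           outputs p (i' # \<sigma>) \<subseteq> C b' \<and>
           (\<forall>t. a' < t \<longrightarrow> t \<le> b' \<longrightarrow> m \<le> card (C t \<inter> (stages \<sigma> i - interior (i' # \<sigma>))))"
  using assms
proof (induction m arbitrary: i a b)
  case (0 i a b)
  have "p \<le> Suc i" using 0 by simp
  obtain i0 g d c where "i0 \<le> i" "a \<le> g" "g < d" "d < c" "c \<le> b"
      "C g \<inter> interior (i0 # \<sigma>) = {}" "outputs p (i0 # \<sigma>) \<subseteq> C d"
    by (rule stage_recomputed[OF "0.prems"(1-5) \<open>p \<le> Suc i\<close>]) blast
  then show ?case by (intro exI[of _ i0] exI[of _ g] exI[of _ d] conjI) auto
next
  case (Suc m i a b)
  have "p \<le> Suc i" using Suc.prems by simp
  obtain i0 g d c where i0: "i0 \<le> i" "i < i0 + p" and times: "a \<le> g" "g < d" "d < c" "c \<le> b"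
      and comp: "C g \<inter> interior (i0 # \<sigma>) = {}" "outputs p (i0 # \<sigma>) \<subseteq> C d"
      and inp: "inputs p (i0 # \<sigma>) \<subseteq> C c"
      and busy: "\<And>t. g < t \<Longrightarrow> t \<le> c \<Longrightarrow> C t \<inter> subtree (i0 # \<sigma>) \<noteq> {}"
    by (rule stage_recomputed[OF Suc.prems(1-5) \<open>p \<le> Suc i\<close>]) blast
  let ?out = "\<lambda>i'. stages \<sigma> i - interior (i' # \<sigma>)"
  show ?case
  proof (cases "\<forall>t. g < t \<longrightarrow> t \<le> d \<longrightarrow> Suc m \<le> card (C t \<inter> ?out i0)")
    case True
    then show ?thesis using i0 times comp by (intro exI[of _ i0] exI[of _ g] exI[of _ d] conjI) auto
  next
    case False
    \<comment> \<open>At time \<open>e\<close> the count outside the interior drops to at most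
      \<open>m\<close>, which is less than \<open>p\<close>.\<close>
    then obtain e where e: "g < e" "e \<le> d" "card (C e \<inter> ?out i0) < p"
      using Suc.prems(6) by force
    \<comment> \<open>Choosing \<open>i0\<close> lost fewer than \<open>p\<close> stages, so the
      stage \<open>j\<close> just before it still meets the bound for \<open>m\<close>.\<close>
    have "Suc m * p + p \<le> i0 + p" using Suc.prems(7) i0 by linarith
    then obtain j where j: "i0 = Suc j" "m * p + p \<le> Suc j"
      using p by (cases i0) auto
    have "stages \<sigma> j \<inter> interior (i0 # \<sigma>) = {}"
      using stages_disjoint[of j i0 \<sigma>] interior_subset[of "i0 # \<sigma>"] j by auto
    then have sub: "stages \<sigma> j \<subseteq> ?out i0"
      using stages_mono[of j i \<sigma>] i0 j by auto
    have "inputs p (i0 # \<sigma>) \<subseteq> ?out i0"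
      using inputs_subset[of p "i0 # \<sigma>"] subtree_subset_stages[OF i0(1)] interior_Int_inputs by blast
    \<comment> \<open>The inputs of stage \<open>i0\<close> lie outside its interior, hence are not
      all covered at \<open>e\<close>, yet all are needed at \<open>c\<close>.\<close>
    then obtain v where v: "v \<in> inputs p (i0 # \<sigma>)" "v \<notin> C e"
      using missing[of e "?out i0" "inputs p (i0 # \<sigma>)"] e(3) by auto
    then obtain c' where c': "e \<le> c'" "c' < c" "preds K q p v \<subseteq> C c'"
      using placement[of v e c] inp e times by auto
    have "Link (j # \<sigma>) \<in> C c'" "outputs p (j # \<sigma>) \<subseteq> C c'"
      using v(1) c'(3) by (auto simp: inputs_def j)
    moreover have "card (C e \<inter> stages \<sigma> j) < p"
      using e(3) sub by (meson card_mono finite_C finite_Int Int_mono order.strict_trans1 order_refl)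
    ultimately obtain i' a' b' where i': "i' \<le> j" "e \<le> a'" "a' < b'" "b' \<le> c'"
        "C a' \<inter> interior (i' # \<sigma>) = {}" "outputs p (i' # \<sigma>) \<subseteq> C b'"
        and count: "\<And>t. a' < t \<Longrightarrow> t \<le> b' \<Longrightarrow> m \<le> card (C t \<inter> (stages \<sigma> j - interior (i' # \<sigma>)))"
      using Suc.IH[of e j c'] Suc.prems c' j by auto
    \<comment> \<open>The pebble that stays in stage \<open>i0\<close> until \<open>c\<close> lies
      beyond stage \<open>j\<close> and adds one to the inductive count.\<close>
    have "Suc m \<le> card (C t \<inter> ?out i')" if t: "a' < t" "t \<le> b'" for t
    proof -
      obtain x where x: "x \<in> C t" "x \<in> subtree (i0 # \<sigma>)"
        using busy[of t] t i' e c' by (auto simp: disjoint_iff)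
      have "x \<notin> stages \<sigma> j" using stages_disjoint[of j i0 \<sigma>] x j by auto
      have "x \<notin> interior (i' # \<sigma>)"
        using subtree_disjoint[of i' i0 \<sigma>] interior_subset[of "i' # \<sigma>"] x i' j by auto
      have "Suc m \<le> card (insert x (C t \<inter> (stages \<sigma> j - interior (i' # \<sigma>))))"
        using count[OF t] \<open>x \<notin> stages \<sigma> j\<close> by simp
      also have "\<dots> \<le> card (C t \<inter> ?out i')"
        using x \<open>x \<notin> interior (i' # \<sigma>)\<close> stages_mono[of j i \<sigma>] i0 j subtree_subset_stages[OF i0(1), of \<sigma>]
        by (intro card_mono) auto
      finally show ?thesis .
    qed
    then show ?thesis
      using i' i0 j times e c' by (intro exI[of _ i'] exI[of _ a'] exI[of _ b'] conjI) auto
  qed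
qed

text \<open>Each level contributes \<open>p\<close>: some submodule is pebbled from an empty
  interior while at least \<open>p\<close> pebbles stay outside that interior throughout. The
  induction hypothesis picks a moment at which its interior is expensive too.\<close>

theorem interior_bound:
  assumes "length \<sigma> \<le> K" "C a \<inter> interior \<sigma> = {}" "outputs p \<sigma> \<subseteq> C b" "a \<le> b"
  shows "\<exists>t>a. t \<le> b \<and> (K - length \<sigma>) * p \<le> card (C t \<inter> interior \<sigma>)"
  using assms
proof (induction "K - length \<sigma>" arbitrary: \<sigma> a b)
  case 0
  have "outputs p \<sigma> \<noteq> {}" using p by (auto simp: outputs_def)
  then have "a \<noteq> b" using 0 outputs_subset[of p \<sigma>] by auto
  then show ?case using 0 by (intro exI[of _ b]) auto
next
  case (Suc k)
  have "q \<noteq> 0" "length \<sigma> < K" "k = K - length (i # \<sigma>)" for i using p q Suc.hyps(2) by auto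
  have "Outp \<sigma> 0 \<notin> C a" using Suc.prems by (auto simp: interior_def)
  moreover have "Outp \<sigma> 0 \<in> C b" using Suc.prems p by (auto simp: outputs_def)
  ultimately obtain c where c: "a \<le> c" "c < b" "Link ((q - 1) # \<sigma>) \<in> C c" "outputs p ((q - 1) # \<sigma>) \<subseteq> C c"
    using placement[of "Outp \<sigma> 0" a b] Suc.prems(4) \<open>length \<sigma> < K\<close> by auto
  have "C a \<inter> stages \<sigma> (q - 1) = {}" using Suc.prems(2) stages_subset[of \<sigma> "q - 1"] by auto
  \<comment> \<open>This is the case \<open>m = p\<close> at the last stage; its bound is exactly
    \<open>p * p + p \<le> q\<close>.\<close>
  then obtain i' a' b' where i': "i' \<le> q - 1" "a \<le> a'" "a' < b'" "b' \<le> c"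
      "C a' \<inter> interior (i' # \<sigma>) = {}" "outputs p (i' # \<sigma>) \<subseteq> C b'"
      and count: "\<And>t. a' < t \<Longrightarrow> t \<le> b' \<Longrightarrow> p \<le> card (C t \<inter> (stages \<sigma> (q - 1) - interior (i' # \<sigma>)))"
    using stage_blocked[of \<sigma> a "q - 1" c p] c \<open>length \<sigma> < K\<close> p q \<open>q \<noteq> 0\<close> by auto
  obtain t where t: "a' < t" "t \<le> b'" "(K - length (i' # \<sigma>)) * p \<le> card (C t \<inter> interior (i' # \<sigma>))"
    using Suc.hyps(1)[of "i' # \<sigma>" a' b'] \<open>k = K - length (i' # \<sigma>)\<close> \<open>length \<sigma> < K\<close> i' by auto
  have "(K - length \<sigma>) * p = p + (K - length (i' # \<sigma>)) * p"
    unfolding Suc.hyps(2)[symmetric] \<open>k = K - length (i' # \<sigma>)\<close>[symmetric] by simp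
  also have "\<dots> \<le> card (C t \<inter> (stages \<sigma> (q - 1) - interior (i' # \<sigma>))) + card (C t \<inter> interior (i' # \<sigma>))"
    using count t by (intro add_mono) auto
  also have "\<dots> = card (C t \<inter> (stages \<sigma> (q - 1) - interior (i' # \<sigma>)) \<union> C t \<inter> interior (i' # \<sigma>))"
    by (intro card_Un_disjoint[symmetric]) auto
  also have "\<dots> \<le> card (C t \<inter> interior \<sigma>)"
    using stages_subset[of \<sigma> "q - 1"] subtree_Cons_subset[of i' \<sigma>] interior_subset[of "i' # \<sigma>"]
    by (intro card_mono) auto
  finally show ?case using t i' c by (intro exI[of _ t]) auto
qed

end

section \<open>The separation\<close>

definition addresses :: "nat \<Rightarrow> nat \<Rightarrow> nat list set" where
  "addresses K q = {\<sigma>. set \<sigma> \<subseteq> {..<q} \<and> length \<sigma> \<le> K}"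

definition vertices :: "nat \<Rightarrow> nat \<Rightarrow> nat \<Rightarrow> vertex set" where
  "vertices K q p = (\<Union>\<sigma>\<in>addresses K q. inputs p \<sigma> \<union> outputs p \<sigma> \<union> {Done \<sigma>, Link \<sigma>})"

definition tower_cnf :: "nat \<Rightarrow> nat \<Rightarrow> nat \<Rightarrow> cnf" where
  "tower_cnf K q p = pebbling_cnf (preds K q p) (vertices K q p) (outputs p [])"

lemma finite_inputs [simp]: "finite (inputs p \<sigma>)"
  and finite_outputs [simp]: "finite (outputs p \<sigma>)"
  by (simp_all add: inputs_def outputs_def)

lemma preds_inputs_outputs:
  "v \<in> inputs p [] \<Longrightarrow> preds K q p v = {}"
  "v \<in> inputs p (0 # \<sigma>) \<Longrightarrow> preds K q p v = inputs p \<sigma>"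
  "v \<in> inputs p (Suc i # \<sigma>) \<Longrightarrow> preds K q p v = insert (Link (i # \<sigma>)) (outputs p (i # \<sigma>))"
  "v \<in> outputs p \<sigma> \<Longrightarrow> length \<sigma> = K \<Longrightarrow> preds K q p v = inputs p \<sigma>"
  "v \<in> outputs p \<sigma> \<Longrightarrow> length \<sigma> < K \<Longrightarrow>
     preds K q p v = insert (Link ((q - 1) # \<sigma>)) (outputs p ((q - 1) # \<sigma>))"
  by (auto simp: inputs_def outputs_def)

lemma finite_addresses [simp]: "finite (addresses K q)"
  unfolding addresses_def by (rule finite_lists_length_le) simp

lemma finite_vertices [simp]: "finite (vertices K q p)"
  by (simp add: vertices_def)

lemma finite_preds [simp]: "finite (preds K q p v)"
  by (induction K q p v rule: preds.induct) auto

lemma address_Nil [simp]: "[] \<in> addresses K q"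
  by (simp add: addresses_def)

lemma address_Cons: "i < q \<Longrightarrow> \<sigma> \<in> addresses K q \<Longrightarrow> length \<sigma> < K \<Longrightarrow> i # \<sigma> \<in> addresses K q"
  by (auto simp: addresses_def)

lemma address_tl: "i # \<sigma> \<in> addresses K q \<Longrightarrow> i < q \<and> \<sigma> \<in> addresses K q \<and> length \<sigma> < K"
  by (auto simp: addresses_def)

lemma vertex_in_vertices:
  assumes "\<sigma> \<in> addresses K q"
  shows "inputs p \<sigma> \<subseteq> vertices K q p" "outputs p \<sigma> \<subseteq> vertices K q p"
    "Done \<sigma> \<in> vertices K q p" "Link \<sigma> \<in> vertices K q p"
  using assms by (auto simp: vertices_def)

text \<open>Closure under predecessors makes the vertices exactly the variables of the formula. With
  \<open>0 < q\<close> the index \<open>q - 1\<close> is a genuine stage.\<close>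

lemma preds_subset_vertices:
  assumes "v \<in> vertices K q p" "0 < q"
  shows "preds K q p v \<subseteq> vertices K q p"
proof -
  from assms(1) obtain \<sigma> where \<sigma>: "\<sigma> \<in> addresses K q"
      "v \<in> inputs p \<sigma> \<or> v \<in> outputs p \<sigma> \<or> v = Done \<sigma> \<or> v = Link \<sigma>"
    by (auto simp: vertices_def)
  from \<sigma>(2) consider j where "v = Inp \<sigma> j" | j where "v = Outp \<sigma> j" | "v = Done \<sigma>" | "v = Link \<sigma>"
    by (auto simp: inputs_def outputs_def)
  then show ?thesis
  proof cases
    case (1 j)
    show ?thesis
    proof (cases \<sigma>)
      case (Cons i \<tau>)
      then have \<tau>: "i < q" "\<tau> \<in> addresses K q" "length \<tau> < K" using address_tl \<sigma> by blast+
      show ?thesis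
      proof (cases i)
        case (Suc i')
        then have "i' # \<tau> \<in> addresses K q" using \<tau> by (intro address_Cons) auto
        then show ?thesis using vertex_in_vertices[of "i' # \<tau>"] 1 Cons Suc by auto
      qed (use vertex_in_vertices[OF \<tau>(2)] 1 Cons in auto)
    qed (use 1 in auto)
  next
    case (2 j)
    show ?thesis
    proof (cases "length \<sigma> = K")
      case False
      then have "(q - 1) # \<sigma> \<in> addresses K q"
        using \<sigma> assms(2) by (intro address_Cons) (auto simp: addresses_def)
      then show ?thesis using vertex_in_vertices[of "(q - 1) # \<sigma>"] 2 False by auto
    qed (use vertex_in_vertices[OF \<sigma>(1)] 2 in auto)
  qed (use vertex_in_vertices[OF \<sigma>(1)] in auto)
qed

lemma cnf_vars_pebbling:
  assumes "\<And>v. v \<in> U \<Longrightarrow> pred v \<subseteq> U" "T \<subseteq> U"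
  shows "cnf_vars (pebbling_cnf pred U T) = to_nat ` U"
  using assms unfolding cnf_vars_def pebbling_cnf_def by force

lemma cnf_vars_tower: "0 < q \<Longrightarrow> cnf_vars (tower_cnf K q p) = to_nat ` vertices K q p"
  unfolding tower_cnf_def
  by (intro cnf_vars_pebbling preds_subset_vertices vertex_in_vertices) auto

lemma is_cnf_tower: "is_cnf (tower_cnf K q p)"
  by (auto simp: is_cnf_def tower_cnf_def pebbling_cnf_def)

lemma sat_preds:
  assumes "satisfies \<tau> (pebbling_cnf pred U T)" "v \<in> U" "\<forall>w\<in>pred v. \<tau> (to_nat w)"
  shows "\<tau> (to_nat v)"
  using assms unfolding satisfies_def pebbling_cnf_def by fastforce

section \<open>The upper bound for PC\<close>

abbreviation facts :: "vertex set \<Rightarrow> 'a::field mpoly set" where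
  "facts S \<equiv> fact ` S"

context
  fixes K q p :: nat
  assumes q: "0 < q"
begin

text \<open>The variables are split into those of a remembered context, \<open>Y\<close>, and those
  of the vertices currently worked on.\<close>

lemma bounded_reach_tower:
  fixes C Q :: "'a::field mpoly set" and Y :: "nat set" and S :: "vertex set"
  assumes "finite C" "finite Q" "finite Y" "finite S" "Y \<union> to_nat ` S \<subseteq> cnf_vars (tower_cnf K q p)"
    and "\<And>g. g \<in> C \<Longrightarrow> poly_vars g \<subseteq> Y \<union> to_nat ` S" "card Y + card S \<le> s"
    and "\<And>g. g \<in> Q \<Longrightarrow> PC_derives (tower_cnf K q p) (Y \<union> to_nat ` S) C g"
  shows "bounded_reach (tower_cnf K q p) s C Q"
proof (rule bounded_reach_derives)
  have "card (Y \<union> to_nat ` S) \<le> card Y + card (to_nat ` S)" by (rule card_Un_le)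
  then show "card (Y \<union> to_nat ` S) \<le> s" using assms(7) by (simp add: card_image)
qed (use assms in auto)

lemma derives_fact:
  assumes "v \<in> vertices K q p" "to_nat ` insert v (preds K q p v) \<subseteq> X"
    "\<And>b. b \<in> preds K q p v \<Longrightarrow> fact b \<in> C"
  shows "PC_derives (tower_cnf K q p) X C (fact v)"
  unfolding tower_cnf_def using assms
  by (intro PC_derives_pebble[of v _ "preds K q p" X]) (auto intro: PC_derives.hyp)

lemma facts_vars: "g \<in> facts S \<Longrightarrow> poly_vars g \<subseteq> to_nat ` S"
  using poly_vars_fact by fastforce

lemma to_nat_subset: "S \<subseteq> vertices K q p \<Longrightarrow> to_nat ` S \<subseteq> cnf_vars (tower_cnf K q p)"
  using q by (auto simp: cnf_vars_tower)

lemma advance: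
  fixes \<Gamma> :: "'a::field mpoly set" and Y :: "nat set"
  assumes "finite \<Gamma>" "\<And>g. g \<in> \<Gamma> \<Longrightarrow> poly_vars g \<subseteq> Y" "finite Y" "Y \<subseteq> cnf_vars (tower_cnf K q p)"
    and A: "A \<subseteq> vertices K q p" and B: "B \<subseteq> vertices K q p"
    and "\<And>v. v \<in> B \<Longrightarrow> preds K q p v \<subseteq> A" and "card Y + card A + card B \<le> s"
  shows "bounded_reach (tower_cnf K q p) s (\<Gamma> \<union> facts A) (\<Gamma> \<union> facts B)"
proof (rule bounded_reach_tower[where Y = Y and S = "A \<union> B"])
  have fin: "finite A" "finite B" using A B finite_subset[OF _ finite_vertices] by blast+
  then show "finite (\<Gamma> \<union> facts A)" "finite (\<Gamma> \<union> facts B)" "finite (A \<union> B)"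
    using assms by auto
  show "Y \<union> to_nat ` (A \<union> B) \<subseteq> cnf_vars (tower_cnf K q p)"
    using assms to_nat_subset by auto
  show "poly_vars g \<subseteq> Y \<union> to_nat ` (A \<union> B)" if "g \<in> \<Gamma> \<union> facts A" for g
    using that assms(2)[of g] facts_vars[of g A] by blast
  show "card Y + card (A \<union> B) \<le> s"
    using assms(8) card_Un_le[of A B] by linarith
  show "PC_derives (tower_cnf K q p) (Y \<union> to_nat ` (A \<union> B)) (\<Gamma> \<union> facts A) g"
    if g: "g \<in> \<Gamma> \<union> facts B" for g
  proof (cases "g \<in> \<Gamma>")
    case False
    then obtain v where v: "v \<in> B" "g = fact v" using g by blast
    show ?thesis
      unfolding v(2) using v(1) B assms(7)[OF v(1)] by (intro derives_fact) auto
  qed (auto intro: PC_derives.hyp)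
qed fact

text \<open>The implication from \<open>Done\<close> to \<open>Link\<close> is derived while the
  inputs are present. It survives the passage through the module, where the inputs may be erased,
  and is finally resolved with \<open>Done\<close>, obtained from the outputs. A black pebbling
  would have to hold or recompute the inputs instead.\<close>

lemma stage_reach:
  fixes \<Gamma> :: "'a::field mpoly set" and Y :: "nat set"
  assumes \<tau>: "\<tau> \<in> addresses K q"
    and \<Gamma>: "finite \<Gamma>" "\<And>g. g \<in> \<Gamma> \<Longrightarrow> poly_vars g \<subseteq> Y" "finite Y" "Y \<subseteq> cnf_vars (tower_cnf K q p)"
    and s: "card Y + 2 + p \<le> s"
    and module: "bounded_reach (tower_cnf K q p) s
      (insert (Var (to_nat (Done \<tau>)) * fact (Link \<tau>)) \<Gamma> \<union> facts (inputs p \<tau>))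
      (insert (Var (to_nat (Done \<tau>)) * fact (Link \<tau>)) \<Gamma> \<union> facts (outputs p \<tau>))"
  shows "bounded_reach (tower_cnf K q p) s (\<Gamma> \<union> facts (inputs p \<tau>))
    (\<Gamma> \<union> facts (insert (Link \<tau>) (outputs p \<tau>)))"
proof -
  let ?F = "tower_cnf K q p"
  let ?l = "Var (to_nat (Done \<tau>)) * fact (Link \<tau>) :: 'a mpoly"
  let ?DL = "{Done \<tau>, Link \<tau>}"
  note verts = vertex_in_vertices[OF \<tau>, of p]
  have l: "poly_vars ?l \<subseteq> to_nat ` ?DL"
    using poly_vars_mult[of "Var (to_nat (Done \<tau>))" "fact (Link \<tau>) :: 'a mpoly"] poly_vars_fact[of "Link \<tau>"]
    by auto
  have card: "card Y + card (?DL \<union> S) \<le> s" if "card S = p" for S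
    using card_Un_le[of ?DL S] that s by simp
  have "bounded_reach ?F s (\<Gamma> \<union> facts (inputs p \<tau>)) (insert ?l \<Gamma> \<union> facts (inputs p \<tau>))"
  proof (rule bounded_reach_tower[where Y = Y and S = "?DL \<union> inputs p \<tau>"])
    let ?X = "Y \<union> to_nat ` (?DL \<union> inputs p \<tau>)"
    show "?X \<subseteq> cnf_vars ?F"
      using \<Gamma>(4) to_nat_subset[of "?DL \<union> inputs p \<tau>"] verts by auto
    show "poly_vars g \<subseteq> ?X" if "g \<in> \<Gamma> \<union> facts (inputs p \<tau>)" for g
      using that \<Gamma>(2)[of g] facts_vars[of g "inputs p \<tau>"] by blast
    have "PC_derives ?F ?X (\<Gamma> \<union> facts (inputs p \<tau>)) ?l"
      unfolding tower_cnf_def using verts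
      by (intro PC_derives_pebble_conditional[where pred = "preds K q p"]) (auto intro: PC_derives.hyp)
    then show "PC_derives ?F ?X (\<Gamma> \<union> facts (inputs p \<tau>)) g" if "g \<in> insert ?l \<Gamma> \<union> facts (inputs p \<tau>)" for g
      using that by (auto intro: PC_derives.hyp)
  qed (use \<Gamma> card in auto)
  moreover have "bounded_reach ?F s (insert ?l \<Gamma> \<union> facts (outputs p \<tau>)) (\<Gamma> \<union> facts (insert (Link \<tau>) (outputs p \<tau>)))"
  proof (rule bounded_reach_tower[where Y = Y and S = "?DL \<union> outputs p \<tau>"])
    let ?X = "Y \<union> to_nat ` (?DL \<union> outputs p \<tau>)" and ?C = "insert ?l \<Gamma> \<union> facts (outputs p \<tau>)"
    show "?X \<subseteq> cnf_vars ?F"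
      using \<Gamma>(4) to_nat_subset[of "?DL \<union> outputs p \<tau>"] verts by auto
    show "poly_vars g \<subseteq> ?X" if "g \<in> ?C" for g
      using that l \<Gamma>(2)[of g] facts_vars[of g "outputs p \<tau>"] by blast
    have "PC_derives ?F ?X ?C (fact (Done \<tau>))"
      using verts by (intro derives_fact) auto
    moreover have "PC_derives ?F ?X ?C ((\<Prod>b\<in>{to_nat (Done \<tau>)}. Var b) * fact (Link \<tau>))"
      by (auto intro: PC_derives.hyp)
    ultimately have "PC_derives ?F ?X ?C (fact (Link \<tau>))"
      by (rule_tac PC_derives_resolve[of "{to_nat (Done \<tau>)}"]) (auto intro: closed_multiplier_intros)
    then show "PC_derives ?F ?X ?C g" if "g \<in> \<Gamma> \<union> facts (insert (Link \<tau>) (outputs p \<tau>))" for g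
      using that by (auto intro: PC_derives.hyp)
  qed (use \<Gamma> card in auto)
  ultimately show ?thesis
    using module by (meson rtranclp_trans)
qed

text \<open>Each level on the current path stores one implication, that is two variables. The
  remaining \<open>2 * p + 1\<close> pay for two adjacent layers and a link.\<close>

lemma module_reach:
  fixes \<Gamma> :: "'a::field mpoly set" and Y :: "nat set"
  assumes "\<sigma> \<in> addresses K q" "finite \<Gamma>" "\<And>g. g \<in> \<Gamma> \<Longrightarrow> poly_vars g \<subseteq> Y" "finite Y"
    "Y \<subseteq> cnf_vars (tower_cnf K q p)" "card Y + 2 * (K - length \<sigma>) + 2 * p + 1 \<le> s"
  shows "bounded_reach (tower_cnf K q p) s (\<Gamma> \<union> facts (inputs p \<sigma>)) (\<Gamma> \<union> facts (outputs p \<sigma>))"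
  using assms
proof (induction "K - length \<sigma>" arbitrary: \<sigma> \<Gamma> Y)
  case 0
  have "length \<sigma> = K" using 0 by (auto simp: addresses_def)
  then have "preds K q p v \<subseteq> inputs p \<sigma>" if "v \<in> outputs p \<sigma>" for v
    using that by (simp add: preds_inputs_outputs)
  then show ?case
    using 0 vertex_in_vertices[OF "0.prems"(1)] by (intro advance[where Y = Y]) auto
next
  case (Suc k)
  let ?F = "tower_cnf K q p"
  have len: "length \<sigma> < K" "k = K - length (i # \<sigma>)" for i using Suc.hyps(2) by auto
  note \<Gamma> = Suc.prems(2-5)
  have addr: "i # \<sigma> \<in> addresses K q" if "i < q" for i
    using address_Cons that Suc.prems(1) len by blast
  have stage: "bounded_reach ?F s (\<Gamma> \<union> facts (inputs p (i # \<sigma>)))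
      (\<Gamma> \<union> facts (insert (Link (i # \<sigma>)) (outputs p (i # \<sigma>))))" if "i < q" for i
  proof (rule stage_reach[OF addr[OF that] \<Gamma>])
    let ?l = "Var (to_nat (Done (i # \<sigma>))) * fact (Link (i # \<sigma>)) :: 'a mpoly"
    \<comment> \<open>The implication joins the context of the submodule; the two extra variables
      are paid for by the decrease in remaining depth.\<close>
    let ?Y = "Y \<union> to_nat ` {Done (i # \<sigma>), Link (i # \<sigma>)}"
    have "card ?Y \<le> card Y + 2"
      using card_Un_le[of Y "to_nat ` {Done (i # \<sigma>), Link (i # \<sigma>)}"]
      by (simp add: card_image)
    moreover have "poly_vars ?l \<subseteq> ?Y"
      using poly_vars_mult[of "Var (to_nat (Done (i # \<sigma>)))" "fact (Link (i # \<sigma>)) :: 'a mpoly"]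
        poly_vars_fact[of "Link (i # \<sigma>)"] by auto
    moreover have "?Y \<subseteq> cnf_vars ?F"
      using \<Gamma>(4) to_nat_subset[of "{Done (i # \<sigma>), Link (i # \<sigma>)}"] vertex_in_vertices[OF addr[OF that]] by auto
    moreover have "2 * (K - length \<sigma>) = 2 * (K - length (i # \<sigma>)) + 2"
      using len by auto
    ultimately show "bounded_reach ?F s (insert ?l \<Gamma> \<union> facts (inputs p (i # \<sigma>)))
        (insert ?l \<Gamma> \<union> facts (outputs p (i # \<sigma>)))"
      using \<Gamma> Suc.prems(6) by (intro Suc.hyps(1)[OF len(2) addr[OF that], of _ ?Y]) auto
    show "card Y + 2 + p \<le> s"
      using Suc.prems(6) Suc.hyps(2) by simp
  qed
  have space: "card Y + card A + card B \<le> s" if "card A \<le> Suc p" "card B \<le> p" for A B :: "vertex set"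
    using Suc.prems(6) that by simp
  have Link: "insert (Link (i # \<sigma>)) (outputs p (i # \<sigma>)) \<subseteq> vertices K q p" if "i < q" for i
    using vertex_in_vertices[OF addr[OF that]] by auto
  \<comment> \<open>The inputs of each stage are reached in turn along the line.\<close>
  have "bounded_reach ?F s (\<Gamma> \<union> facts (inputs p \<sigma>)) (\<Gamma> \<union> facts (inputs p (i # \<sigma>)))" if "i < q" for i
    using that
  proof (induction i)
    case 0
    show ?case
      using \<Gamma> vertex_in_vertices[OF Suc.prems(1)] vertex_in_vertices[OF addr[OF 0]]
      by (intro advance[where Y = Y] space) (auto simp: preds_inputs_outputs)
  next
    case (Suc i)
    have "bounded_reach ?F s (\<Gamma> \<union> facts (insert (Link (i # \<sigma>)) (outputs p (i # \<sigma>))))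
        (\<Gamma> \<union> facts (inputs p (Suc i # \<sigma>)))"
      using \<Gamma> Link[of i] vertex_in_vertices[OF addr[OF Suc.prems]] Suc.prems
      by (intro advance[where Y = Y] space) (auto simp: preds_inputs_outputs card_insert_if)
    then show ?case
      using Suc.IH stage[of i] Suc.prems by (meson Suc_lessD rtranclp_trans)
  qed
  from this[of "q - 1"] stage[of "q - 1"]
  have "bounded_reach ?F s (\<Gamma> \<union> facts (inputs p \<sigma>))
      (\<Gamma> \<union> facts (insert (Link ((q - 1) # \<sigma>)) (outputs p ((q - 1) # \<sigma>))))"
    using q by (meson diff_less rtranclp_trans zero_less_one)
  moreover have "bounded_reach ?F s
      (\<Gamma> \<union> facts (insert (Link ((q - 1) # \<sigma>)) (outputs p ((q - 1) # \<sigma>)))) (\<Gamma> \<union> facts (outputs p \<sigma>))"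
    using \<Gamma> Link[of "q - 1"] vertex_in_vertices[OF Suc.prems(1)] q len(1)
    by (intro advance[where Y = Y] space) (auto simp: preds_inputs_outputs card_insert_if)
  ultimately show ?case by (rule rtranclp_trans)
qed

lemma VSpace_PC_tower: "VSpace PC TYPE('a::field) (tower_cnf K q p) \<le> 2 * K + 2 * p + 1"
proof (rule VSpace_PC_le)
  let ?F = "tower_cnf K q p" and ?s = "2 * K + 2 * p + 1"
  \<comment> \<open>The inputs of the root are sources, so they follow from the empty layer.\<close>
  have "bounded_reach ?F ?s ({} \<union> facts {} :: 'a mpoly set) ({} \<union> facts (inputs p []))"
    using vertex_in_vertices[OF address_Nil, of p K q]
    by (intro advance[where Y = "{}"]) (auto simp: preds_inputs_outputs)
  moreover have "bounded_reach ?F ?s ({} \<union> facts (inputs p []) :: 'a mpoly set) ({} \<union> facts (outputs p []))"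
    by (intro module_reach[where Y = "{}"]) auto
  moreover have "bounded_reach ?F ?s (facts (outputs p []) :: 'a mpoly set) {1}"
  proof (rule bounded_reach_tower[where Y = "{}" and S = "outputs p []"])
    let ?X = "{} \<union> to_nat ` outputs p []"
    show "?X \<subseteq> cnf_vars ?F"
      using to_nat_subset vertex_in_vertices(2)[OF address_Nil] by simp
    show "poly_vars g \<subseteq> ?X" if "g \<in> facts (outputs p [])" for g
      using that facts_vars by blast
    have "clause_poly ({}, to_nat ` outputs p []) \<in> axioms_of ?F"
      by (auto simp: axioms_of_def tower_cnf_def pebbling_cnf_def simp del: clause_poly.simps)
    then have "(\<Prod>b\<in>to_nat ` outputs p []. Var b) * 1 \<in> axioms_of ?F"
      by simp
    moreover have "poly_vars ((\<Prod>b\<in>to_nat ` outputs p []. Var b) * 1) \<subseteq> ?X"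
      using poly_vars_prod[of "to_nat ` outputs p []" Var] by simp
    ultimately have "PC_derives ?F ?X (facts (outputs p [])) 1"
      by (rule_tac PC_derives_resolve[OF _ _ PC_derives.ax]) (auto intro: PC_derives.hyp closed_multiplier_intros)
    then show "PC_derives ?F ?X (facts (outputs p [])) g" if "g \<in> {1}" for g
      using that by simp
  qed auto
  ultimately show "bounded_reach ?F ?s {} {1 :: 'a mpoly}"
    by (simp only: image_empty Un_empty_left)
qed

text \<open>Truth propagates from the sources through all modules in the order of the PC refutation
  and finally contradicts the goal clause.\<close>

lemma unsatisfiable_tower: "unsatisfiable (tower_cnf K q p)"
proof -
  have False if sat: "satisfies \<tau> (tower_cnf K q p)" for \<tau>
  proof -
    have step: "\<tau> (to_nat v)" if "v \<in> vertices K q p" "\<And>w. w \<in> preds K q p v \<Longrightarrow> \<tau> (to_nat w)" for v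
      using sat_preds[of \<tau> "preds K q p" "vertices K q p" "outputs p []" v] sat that by (auto simp: tower_cnf_def)
    have module: "\<forall>v\<in>outputs p \<sigma>. \<tau> (to_nat v)"
      if "\<sigma> \<in> addresses K q" "\<forall>v\<in>inputs p \<sigma>. \<tau> (to_nat v)" for \<sigma>
      using that
    proof (induction "K - length \<sigma>" arbitrary: \<sigma>)
      case 0
      then have "length \<sigma> = K" by (auto simp: addresses_def)
      then show ?case
        using "0.prems" vertex_in_vertices[OF "0.prems"(1), of p] by (intro ballI, rule_tac step) (auto simp: preds_inputs_outputs)
    next
      case (Suc k)
      have len: "length \<sigma> < K" "k = K - length (i # \<sigma>)" for i using Suc.hyps(2) by auto
      have addr: "i # \<sigma> \<in> addresses K q" if "i < q" for i
        using address_Cons that Suc.prems(1) len by blast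
      have stage: "\<forall>v\<in>insert (Link (i # \<sigma>)) (outputs p (i # \<sigma>)). \<tau> (to_nat v)"
        if "i < q" "\<forall>v\<in>inputs p (i # \<sigma>). \<tau> (to_nat v)" for i
      proof -
        note verts = vertex_in_vertices[OF addr[OF that(1)], of p]
        have out: "\<forall>v\<in>outputs p (i # \<sigma>). \<tau> (to_nat v)"
          using Suc.hyps(1)[OF len(2) addr[OF that(1)] that(2)] .
        have "\<tau> (to_nat (Done (i # \<sigma>)))" using out verts by (rule_tac step) auto
        then have "\<tau> (to_nat (Link (i # \<sigma>)))" using that(2) verts by (rule_tac step) auto
        then show ?thesis using out by simp
      qed
      have "\<forall>v\<in>inputs p (i # \<sigma>). \<tau> (to_nat v)" if "i < q" for i
        using that
      proof (induction i)
        case 0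
        then show ?case
          using Suc.prems(2) vertex_in_vertices[OF addr[OF 0], of p] by (intro ballI, rule_tac step) (auto simp: preds_inputs_outputs)
      next
        case (Suc i)
        then have "\<forall>v\<in>insert (Link (i # \<sigma>)) (outputs p (i # \<sigma>)). \<tau> (to_nat v)"
          by (intro stage) auto
        then show ?case
          using vertex_in_vertices[OF addr[OF Suc.prems], of p] by (intro ballI, rule_tac step) (auto simp: preds_inputs_outputs)
      qed
      from this[of "q - 1"] have "\<forall>v\<in>inputs p ((q - 1) # \<sigma>). \<tau> (to_nat v)" using q by simp
      then have "\<forall>v\<in>insert (Link ((q - 1) # \<sigma>)) (outputs p ((q - 1) # \<sigma>)). \<tau> (to_nat v)"
        using q by (intro stage) auto
      then show ?case
        using vertex_in_vertices[OF Suc.prems(1), of p] len(1) by (intro ballI, rule_tac step) (auto simp: preds_inputs_outputs)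
    qed
    have "\<forall>v\<in>inputs p []. \<tau> (to_nat v)"
      using vertex_in_vertices[OF address_Nil, of p] by (intro ballI, rule_tac step) (auto simp: preds_inputs_outputs)
    then have "\<forall>v\<in>outputs p []. \<tau> (to_nat v)"
      by (rule module[OF address_Nil])
    then show False
      using sat by (auto simp: satisfies_def tower_cnf_def pebbling_cnf_def)
  qed
  then show ?thesis by (auto simp: unsatisfiable_def)
qed

end

text \<open>The minimum in \<open>VSpace\<close> is attained because a refutation exists; an optimal
  one yields a black pebbling, to which \<open>interior_bound\<close> applies at the root.\<close>

lemma VSpace_MC_tower:
  assumes "0 < p" "p * p + p \<le> q"
  shows "K * p \<le> VSpace MC TYPE('a::field) (tower_cnf K q p)"
proof -
  let ?F = "tower_cnf K q p"
  have "0 < q" using assms by auto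
  have "\<exists>s. \<exists>Cs :: 'a mpoly set list. refutation MC ?F Cs \<and> variable_space Cs = s"
    using refutation_exists[OF is_cnf_tower unsatisfiable_tower[OF \<open>0 < q\<close>]] by blast
  from LeastI_ex[OF this] obtain Cs :: "'a mpoly set list" where
    Cs: "refutation MC ?F Cs" "variable_space Cs = VSpace MC TYPE('a) ?F"
    unfolding VSpace_def by blast
  obtain C n where C: "black_pebbling (preds K q p) C" "C 0 = {}" "outputs p [] \<subseteq> C n"
      "\<And>t. card (C t) \<le> variable_space Cs"
    using MC_refutation_black_pebbling[OF Cs(1)[unfolded tower_cnf_def]] by auto
  interpret tower_pebbling K q p C
    using C(1) assms by (intro tower_pebbling.intro tower_pebbling_axioms.intro)
  obtain t where "K * p \<le> card (C t \<inter> interior [])"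
    using interior_bound[of "[]" 0 n] C by auto
  also have "\<dots> \<le> card (C t)" by (intro card_mono) auto
  also have "\<dots> \<le> VSpace MC TYPE('a) ?F" using C(4) Cs(2) by simp
  finally show ?thesis .
qed

text \<open>From below, one vertex per innermost module is counted; from above,
  \<open>2 * p + 2\<close> per address, with each of the \<open>K + 1\<close> levels estimated by
  \<open>q ^ K\<close>.\<close>

lemma card_vertices:
  assumes "0 < q"
  shows "q ^ K \<le> card (vertices K q p)" "card (vertices K q p) \<le> (2 * p + 2) * (Suc K * q ^ K)"
proof -
  have "q ^ K = card (Done ` {\<sigma>. set \<sigma> \<subseteq> {..<q} \<and> length \<sigma> = K})"
    by (subst card_image) (auto simp: inj_on_def card_lists_length_eq)
  also have "\<dots> \<le> card (vertices K q p)"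
    by (intro card_mono finite_vertices) (auto simp: vertices_def addresses_def)
  finally show "q ^ K \<le> card (vertices K q p)" .
  have "card (vertices K q p) \<le> (\<Sum>\<sigma>\<in>addresses K q. card (inputs p \<sigma> \<union> outputs p \<sigma> \<union> {Done \<sigma>, Link \<sigma>}))"
    unfolding vertices_def by (rule card_UN_le) simp
  also have "\<dots> \<le> (\<Sum>\<sigma>\<in>addresses K q. 2 * p + 2)"
  proof (rule sum_mono)
    fix \<sigma>
    show "card (inputs p \<sigma> \<union> outputs p \<sigma> \<union> {Done \<sigma>, Link \<sigma>}) \<le> 2 * p + 2"
      using card_Un_le[of "inputs p \<sigma> \<union> outputs p \<sigma>" "{Done \<sigma>, Link \<sigma>}"]
        card_Un_le[of "inputs p \<sigma>" "outputs p \<sigma>"] by simp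
  qed
  also have "\<dots> = (2 * p + 2) * (\<Sum>i\<le>K. q ^ i)"
    by (simp add: addresses_def card_lists_length_le)
  also have "\<dots> \<le> (2 * p + 2) * (\<Sum>i\<le>K. q ^ K)"
    using assms by (intro mult_le_mono2 sum_mono power_increasing) auto
  finally show "card (vertices K q p) \<le> (2 * p + 2) * (Suc K * q ^ K)"
    by (simp only: sum_constant card_atMost of_nat_id)
qed

section \<open>Choice of parameters and asymptotics\<close>

theorem theorem4p5:
  shows "\<exists>F :: nat \<Rightarrow> cnf.
    (\<forall>n. is_cnf (F n) \<and> unsatisfiable (F n)) \<and>
    (\<exists>g :: nat \<Rightarrow> real. g \<in> \<Theta>(\<lambda>n. real n * ln (real n)) \<and>
       (\<forall>n. real (card (cnf_vars (F n))) = exp (g n))) \<and>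
    (\<lambda>n. real (VSpace PC TYPE('a::field) (F n))) \<in> O(\<lambda>n. real n) \<and>
    (\<lambda>n. real (VSpace MC TYPE('a) (F n))) \<in> \<Omega>(\<lambda>n. real n ^ 2)"
proof -
  \<comment> \<open>Depth \<open>n\<close> with \<open>p = Suc n\<close> pebbles, positive even for
    \<open>n = 0\<close>, and the least \<open>q\<close> that the lower bound admits.\<close>
  define q :: "nat \<Rightarrow> nat" where "q n = Suc n * Suc n + Suc n" for n
  define F where "F n = tower_cnf n (q n) (Suc n)" for n
  define N where "N n = card (cnf_vars (F n))" for n
  have q: "0 < q n" for n by (simp add: q_def)
  have real_q: "real (q n) = (real n + 1) * (real n + 1) + (real n + 1)" for n
    by (simp add: q_def algebra_simps)
  have N: "N n = card (vertices n (q n) (Suc n))" for n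
    unfolding N_def F_def cnf_vars_tower[OF q] by (simp add: card_image)
  have lower: "real (q n) ^ n \<le> real (N n)" for n
    using card_vertices(1)[OF q, of n n "Suc n"] unfolding N by (metis of_nat_le_iff of_nat_power)
  have "N n \<le> (2 * Suc n + 2) * (Suc n * q n ^ n)" for n
    using card_vertices(2)[OF q, of n n "Suc n"] unfolding N .
  then have upper: "real (N n) \<le> (2 * real n + 4) * ((real n + 1) * real (q n) ^ n)" for n
    using of_nat_mono[of "N n" "(2 * Suc n + 2) * (Suc n * q n ^ n)", where 'a = real]
    by (simp add: algebra_simps)
  have N_pos: "0 < real (N n)" for n
    using lower[of n] q[of n] by (meson less_le_trans of_nat_0_less_iff zero_less_power)
  have ln_lower: "real n * ln (real (q n)) \<le> ln (real (N n))" for n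
    using lower[of n] q[of n] N_pos[of n] by (subst ln_realpow[symmetric]) auto
  have ln_upper: "ln (real (N n)) \<le> ln (2 * real n + 4) + (ln (real n + 1) + real n * ln (real (q n)))" for n
  proof -
    have "ln (real (N n)) \<le> ln ((2 * real n + 4) * ((real n + 1) * real (q n) ^ n))"
      using upper[of n] N_pos[of n] by (subst ln_le_cancel_iff) auto
    also have "\<dots> = ln (2 * real n + 4) + (ln (real n + 1) + real n * ln (real (q n)))"
      using q[of n] by (simp add: ln_mult ln_realpow)
    finally show ?thesis .
  qed
  have ln_N_nonneg: "0 \<le> ln (real (N n))" for n
    using N_pos[of n] by simp
  \<comment> \<open>Since \<open>q n\<close> is quadratic in \<open>n\<close>, the term
    \<open>n * ln (q n)\<close> dominates and is of order \<open>n * ln n\<close>.\<close>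
  have "(\<lambda>n. ln (real (N n))) \<in> O(\<lambda>n. ln (2 * real n + 4) + (ln (real n + 1) + real n * ln (real (q n))))"
    using ln_N_nonneg by (intro bigoI[of _ 1] always_eventually allI)
      (simp add: order_trans[OF ln_upper abs_ge_self])
  also have "(\<lambda>n. ln (2 * real n + 4) + (ln (real n + 1) + real n * ln (real (q n)))) \<in> O(\<lambda>n. real n * ln (real n))"
    unfolding real_q by real_asymp
  finally have big_o: "(\<lambda>n. ln (real (N n))) \<in> O(\<lambda>n. real n * ln (real n))" .
  have "(\<lambda>n. real n * ln (real n)) \<in> O(\<lambda>n. real n * ln (real (q n)))"
    unfolding real_q by real_asymp
  also have "(\<lambda>n. real n * ln (real (q n))) \<in> O(\<lambda>n. ln (real (N n)))"
    using ln_lower q by (intro bigoI[of _ 1] always_eventually allI) (auto simp: Suc_le_eq ln_N_nonneg)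
  finally have "(\<lambda>n. ln (real (N n))) \<in> \<Omega>(\<lambda>n. real n * ln (real n))"
    by (simp add: bigomega_iff_bigo)
  with big_o have theta: "(\<lambda>n. ln (real (N n))) \<in> \<Theta>(\<lambda>n. real n * ln (real n))"
    by (rule bigthetaI)
  have "VSpace PC TYPE('a) (F n) \<le> 4 * n + 3" for n
    using VSpace_PC_tower[OF q, of n n "Suc n", where 'a = 'a] by (simp add: F_def)
  then have "real (VSpace PC TYPE('a) (F n)) \<le> 4 * real n + 3" for n
    by (metis of_nat_le_iff of_nat_add of_nat_mult of_nat_numeral)
  then have "(\<lambda>n. real (VSpace PC TYPE('a) (F n))) \<in> O(\<lambda>n. 4 * real n + 3)"
    by (intro bigoI[of _ 1] always_eventually allI) auto
  also have "(\<lambda>n. 4 * real n + 3) \<in> O(\<lambda>n. real n)"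
    by real_asymp
  finally have PC: "(\<lambda>n. real (VSpace PC TYPE('a) (F n))) \<in> O(\<lambda>n. real n)" .
  \<comment> \<open>The tower bound is \<open>n * Suc n\<close>.\<close>
  have "n ^ 2 \<le> VSpace MC TYPE('a) (F n)" for n
    using VSpace_MC_tower[of "Suc n" "q n" n, where 'a = 'a] by (simp add: F_def q_def power2_eq_square)
  then have "real n ^ 2 \<le> real (VSpace MC TYPE('a) (F n))" for n
    by (metis of_nat_le_iff of_nat_power)
  then have MC: "(\<lambda>n. real (VSpace MC TYPE('a) (F n))) \<in> \<Omega>(\<lambda>n. real n ^ 2)"
    unfolding bigomega_iff_bigo by (intro bigoI[of _ 1] always_eventually allI) simp
  have "is_cnf (F n) \<and> unsatisfiable (F n)" for n
    using is_cnf_tower unsatisfiable_tower[OF q] by (simp add: F_def)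
  moreover have "real (card (cnf_vars (F n))) = exp (ln (real (N n)))" for n
    using N_pos[of n] by (simp add: N_def)
  ultimately show ?thesis
    using theta PC MC by (intro exI[of _ F] conjI allI exI[of _ "\<lambda>n. ln (real (N n))"]) auto
qed

end
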